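(* Let $p$ be a prime and let $f(X)\in\mathbb{F}_p[X]$ be a square-free quadratic polynomial. For any interval $\mathcal{I}=\{u+1,\ldots,u+H\}$ of $H$ consecutive integers and any subgroup $\mathcal{G}$ of $\mathbb{F}_p^*$ of order $T$, we have $$N_f(\mathcal{I},\mathcal{G})\le \left(1+H^{3/4}p^{-1/8}\right)T^{1/2}p^{o(1)}, \qquad \text{as } H\to\infty.$$
   Context: For a prime $p$, $\mathbb{F}_p$ denotes the finite field of $p$ elements, represented by $\{0,\ldots,p-1\}$, and intervals of consecutive integers are regarded as subsets of $\mathbb{F}_p$ (by reduction modulo $p$). For a polynomial $f\in\mathbb{F}_p[X]$ and sets $\mathcal{S},\mathcal{T}\subseteq\mathbb{F}_p$, put $f(\mathcal{S})=\{f(x): x\in\mathcal{S}\}\subseteq\mathbb{F}_p$ and $N_f(\mathcal{S},\mathcal{T})=\#\left(f(\mathcal{S})\cap\mathcal{T}\right)$. The symbol $o(1)$ denotes a quantity bounded in absolute value by a function of $H$ that tends to $0$ as $H\to\infty$, uniformly over $p$, $f$, $\mathcal{G}$ and the position $u$ of the interval. *)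

theory Defs
  imports Complex_Main "HOL-Number_Theory.Residues" "HOL-Algebra.Polynomials"
begin

definition squarefree_in :: "('a, 'b) monoid_scheme \<Rightarrow> 'a \<Rightarrow> bool" where
  "squarefree_in M a \<longleftrightarrow>
     (\<forall>x \<in> carrier M. (x \<otimes>\<^bsub>M\<^esub> x) divides\<^bsub>M\<^esub> a \<longrightarrow> x \<in> Units M)"

(* The image is taken as a set: an element of T hit by several x in S counts once. *)
definition value_count :: "('a, 'b) ring_scheme \<Rightarrow> 'a list \<Rightarrow> 'a set \<Rightarrow> 'a set \<Rightarrow> nat" where
  "value_count R f S T = card (ring.eval R f ` S \<inter> T)"

(* The integers u+1, ..., u+H reduced modulo p, as a subset of {0..p-1}, the carrier of
   residue_ring p. *)
definition interval_mod :: "nat \<Rightarrow> int \<Rightarrow> nat \<Rightarrow> int set" where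
  "interval_mod p u H = (\<lambda>k. k mod int p) ` {u + 1..u + int H}"

end

theory Submission
  imports Defs "HOL-Algebra.Polynomial_Divisibility"
begin

text \<open>
  Let N be the number of values of f on the interval that lie in the group. The ratio of two such
  values is again in the group, so N^2 is at most the sum over g in G of the number of pairs of values
  with f(x) = g f(y) modulo p. The ratio g = 1 contributes only N \<le> T when one preimage per value is
  counted (\<open>card_values_squared_le\<close>). It remains to bound, for g \<noteq> 1, the points of the conic
  f(x) = g f(y) in a box of side H by (1 + H^(3/2) p^(-1/4)) p^o(1). For H^2 \<ge> p the
  trivial estimate N^2 \<le> H T already gives the result.

  For H^2 < p the modular conic is lifted to the integers (\<open>quadratic_ratio_box_bound\<close>): the box
  principle supplies a multiple of the equation whose coefficients are so small modulo p that the
  congruence splits into O(1 + H^(3/2) p^(-1/4)) equations over the integers. Each of them is a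
  nondegenerate conic, because f has nonzero discriminant and g \<noteq> 1, and completing squares turns it
  into x^2 + d y^2 = n with d, n nonzero and bounded by a power of p.

  Such an equation has only p^o(1) solutions in a box of polynomial size (\<open>conic_points_bound\<close>).
  After removing common factors, the solutions fall into at most as many classes as n has divisors,
  and two solutions of one class differ by an element of norm 1 of a quadratic order
  (\<open>conic_class_dvd\<close>, \<open>card_conic_class\<close>). Elements of norm 1 grow geometrically, so a box
  contains only logarithmically many (\<open>card_norm_one_elements\<close>). The divisor bound then finishes the
  count.

  All estimates are of the form p^\<eta> for arbitrary \<eta> > 0 and H large in terms of \<eta>; in the range
  H^2 < p every constant is absorbed by p^\<eta>. Taking the infimum of the admissible \<eta> for each H gives
  one error function that depends on H alone.
\<close>

section \<open>Norm-one elements of quadratic orders\<close>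

lemma card_le_fibres:
  assumes "finite I" "f ` S \<subseteq> I"
    "\<And>i. i \<in> I \<Longrightarrow> real (card {x \<in> S. f x = i}) \<le> k"
  shows "real (card S) \<le> real (card I) * k"
proof -
  have "S = (\<Union>i\<in>I. {x \<in> S. f x = i})" using assms(2) by auto
  then have "card S = card (\<Union>i\<in>I. {x \<in> S. f x = i})" by simp
  also have "\<dots> \<le> (\<Sum>i\<in>I. card {x \<in> S. f x = i})" by (rule card_UN_le[OF assms(1)])
  finally have "real (card S) \<le> (\<Sum>i\<in>I. real (card {x \<in> S. f x = i}))"
    by (metis of_nat_le_iff of_nat_sum)
  also have "\<dots> \<le> (\<Sum>i\<in>I. k)" by (rule sum_mono) (rule assms(3))
  finally show ?thesis by simp
qed

lemma card_geometric_gaps: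
  fixes A :: "int set" and K :: real
  assumes "A \<noteq> {}" "\<And>x. x \<in> A \<Longrightarrow> 1 \<le> x \<and> real_of_int x \<le> K"
    and gap: "\<And>x y. x \<in> A \<Longrightarrow> y \<in> A \<Longrightarrow> x < y \<Longrightarrow> 5 * x \<le> 4 * y"
  shows "real (card A) \<le> 1 + log (5/4) K"
proof -
  let ?f = "\<lambda>x::int. nat \<lfloor>log (5/4) (real_of_int x)\<rfloor>"
  obtain x0 where "x0 \<in> A" using assms(1) by auto
  then have K1: "1 \<le> K" using assms(2)[of x0] by linarith
  have less: "?f x < ?f y" if "x \<in> A" "y \<in> A" "x < y" for x y
  proof -
    have x1: "1 \<le> x" and y1: "1 \<le> y" using assms(2) that by auto
    have "5/4 * real_of_int x \<le> real_of_int y" using gap[OF that] by linarith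
    then have "log (5/4) (5/4 * real_of_int x) \<le> log (5/4) (real_of_int y)"
      using x1 by simp
    moreover have "log (5/4) (5/4 * real_of_int x) = 1 + log (5/4) (real_of_int x)"
      using x1 by (subst log_mult) auto
    ultimately have "\<lfloor>log (5/4) (real_of_int x)\<rfloor> + 1 \<le> \<lfloor>log (5/4) (real_of_int y)\<rfloor>"
      by linarith
    moreover have "0 \<le> log (5/4) (real_of_int x)" using x1 by (simp add: zero_le_log_cancel_iff)
    ultimately show ?thesis by linarith
  qed
  then have "inj_on ?f A" 
    by (intro linorder_inj_onI') (metis order_less_irrefl)
  moreover have "?f ` A \<subseteq> {..nat \<lfloor>log (5/4) K\<rfloor>}"
  proof
    fix m assume "m \<in> ?f ` A"
    then obtain x where x: "x \<in> A" "m = ?f x" by auto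
    have "log (5/4) (real_of_int x) \<le> log (5/4) K" using assms(2)[OF x(1)] by simp
    then show "m \<in> {..nat \<lfloor>log (5/4) K\<rfloor>}" using x by (simp add: floor_mono nat_mono)
  qed
  ultimately have "card A \<le> card {..nat \<lfloor>log (5/4) K\<rfloor>}" by (meson card_inj_on_le finite_atMost)
  moreover have "0 \<le> log (5/4) K" using K1 by (simp add: zero_le_log_cancel_iff)
  ultimately show ?thesis by simp linarith
qed

text \<open>
  The numbers (x + w sqrt D) / 2 of norm 1 form a multiplicative group. Dividing a larger one by
  a smaller one gives (P + Q sqrt D) / 4 with P^2 - D Q^2 = 16 and Q > 0, hence P \<ge> 5, so consecutive
  elements grow at least by the factor 5/4.
\<close>

lemma norm_one_gap:
  fixes D x1 w1 x2 w2 :: int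
  assumes D: "D > 0" and e1: "x1\<^sup>2 - D * w1\<^sup>2 = 4" and e2: "x2\<^sup>2 - D * w2\<^sup>2 = 4"
    and pos: "x1 > 0" "x2 > 0" "w1 \<ge> 0" "w2 \<ge> 0" and less: "x1 < x2"
  shows "5 * x1 \<le> 4 * x2"
proof -
  define P where "P = x1 * x2 - D * w1 * w2"
  define Q where "Q = w2 * x1 - w1 * x2"
  have norm: "P\<^sup>2 - D * Q\<^sup>2 = 16"
  proof -
    have "P\<^sup>2 - D * Q\<^sup>2 = (x1\<^sup>2 - D * w1\<^sup>2) * (x2\<^sup>2 - D * w2\<^sup>2)"
      unfolding P_def Q_def by (simp add: power2_eq_square algebra_simps)
    then show ?thesis using e1 e2 by simp
  qed
  \<comment> \<open>The identity behind the division: (P + Q sqrt D) / 4 times the smaller element is the larger one.\<close>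
  have lin: "4 * x2 = P * x1 + D * Q * w1"
  proof -
    have "P * x1 + D * Q * w1 = x2 * (x1\<^sup>2 - D * w1\<^sup>2)" unfolding P_def Q_def by (simp add: power2_eq_square algebra_simps)
    then show ?thesis using e1 by simp
  qed
  have x1: "x1\<^sup>2 = 4 + D * w1\<^sup>2" and x2: "x2\<^sup>2 = 4 + D * w2\<^sup>2" using e1 e2 by linarith+
  have "x1\<^sup>2 < x2\<^sup>2" using less pos by (simp add: power_strict_mono)
  have Qsq: "(w2 * x1)\<^sup>2 - (w1 * x2)\<^sup>2 = 4 * (w2\<^sup>2 - w1\<^sup>2)"
  proof -
    have "(w2 * x1)\<^sup>2 - (w1 * x2)\<^sup>2 = w2\<^sup>2 * (x1\<^sup>2 - D * w1\<^sup>2) - w1\<^sup>2 * (x2\<^sup>2 - D * w2\<^sup>2)"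
      by (simp add: power2_eq_square algebra_simps)
    then show ?thesis using e1 e2 by simp
  qed
  have "D * w1\<^sup>2 < D * w2\<^sup>2" using \<open>x1\<^sup>2 < x2\<^sup>2\<close> e1 e2 by linarith
  then have "w1\<^sup>2 < w2\<^sup>2" using D by simp
  then have "0 < (w2 * x1)\<^sup>2 - (w1 * x2)\<^sup>2" unfolding Qsq by simp
  then have "(w1 * x2)\<^sup>2 < (w2 * x1)\<^sup>2" by (simp only: diff_gt_0_iff_gt)
  then have "w1 * x2 < w2 * x1" by (rule power2_less_imp_less) (use pos in simp)
  then have Q: "Q > 0" unfolding Q_def by simp
  have "(D * w1 * w2)\<^sup>2 < (x1 * x2)\<^sup>2"
  proof -
    have "(x1 * x2)\<^sup>2 = (4 + D * w1\<^sup>2) * (4 + D * w2\<^sup>2)" 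
      using x1 x2 by (simp only: power_mult_distrib)
    also have "\<dots> = 16 + 4 * (D * w1\<^sup>2) + 4 * (D * w2\<^sup>2) + (D * w1 * w2)\<^sup>2" by (simp add: power2_eq_square algebra_simps)
    moreover have "0 \<le> D * w1\<^sup>2" "0 \<le> D * w2\<^sup>2" using D by auto
    ultimately show ?thesis by (simp del: power_mult_distrib)
  qed
  then have "D * w1 * w2 < x1 * x2" by (rule power2_less_imp_less) (use pos in simp)
  then have P: "P > 0" unfolding P_def by simp
  have "D * Q\<^sup>2 > 0" using D Q by simp
  then have "P\<^sup>2 > 4\<^sup>2" using norm by simp
  then have "P > 4" by (rule power2_less_imp_less) (use P in simp)
  then have "5 * x1 \<le> P * x1" using pos by simp
  moreover have "0 \<le> D * Q * w1" using D Q pos by simp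
  ultimately show ?thesis using lin by linarith
qed

text \<open>
  For positive d the ellipse itself is small, which accounts for the 25. For negative d the gap of
  \<open>norm_one_gap\<close> leaves only logarithmically many values of |x|, and each belongs to at most four
  pairs (x, w).
\<close>

lemma card_norm_one_elements:
  fixes d :: int and K :: real
  assumes d: "d \<noteq> 0" and K: "K \<ge> 1"
  defines "E \<equiv> {(x, w). x\<^sup>2 + d * w\<^sup>2 = 4 \<and> real_of_int \<bar>x\<bar> \<le> K}"
  shows "finite E" and "real (card E) \<le> 25 + 4 * (1 + log (5/4) K)"
proof -
  have L0: "0 \<le> log (5/4) K" using K by (simp add: zero_le_log_cancel_iff)
  have "finite E \<and> real (card E) \<le> 25 + 4 * (1 + log (5/4) K)"
  proof (cases "d > 0")
    case True
    have sub: "E \<subseteq> {-2..2} \<times> {-2..2}"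
    proof (clarsimp simp: E_def)
      fix x w :: int assume e: "x\<^sup>2 + d * w\<^sup>2 = 4"
      have "1 * w\<^sup>2 \<le> d * w\<^sup>2" using True by (intro mult_right_mono) auto
      then have "x\<^sup>2 \<le> 4" "w\<^sup>2 \<le> 4"
        using e zero_le_power2[of x] zero_le_power2[of w] by linarith+
      then have "x\<^sup>2 \<le> 2\<^sup>2" "w\<^sup>2 \<le> 2\<^sup>2" by simp_all
      then have "\<bar>x\<bar> \<le> 2" "\<bar>w\<bar> \<le> 2"
        using power2_le_iff_abs_le[of 2 x] power2_le_iff_abs_le[of 2 w] by linarith+
      then show "- 2 \<le> x \<and> x \<le> 2 \<and> - 2 \<le> w \<and> w \<le> 2" by linarith
    qed
    have "finite E" using sub by (rule finite_subset) simp
    moreover have "card E \<le> 25" using card_mono[OF _ sub] by (simp add: card_cartesian_product)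
    ultimately show ?thesis using L0 by simp
  next
    case False
    define D where "D = - d"
    have D: "D > 0" using False d D_def by simp
    define A where "A = (\<lambda>z. \<bar>fst z\<bar>) ` E"
    have Epos: "\<bar>x\<bar> \<ge> 1 \<and> \<bar>w\<bar> \<le> \<bar>x\<bar>" if "(x, w) \<in> E" for x w
    proof -
      have e: "x\<^sup>2 = D * w\<^sup>2 + 4" using that by (simp add: E_def D_def)
      have "1 * w\<^sup>2 \<le> D * w\<^sup>2" using D by (intro mult_right_mono) auto
      then have "w\<^sup>2 \<le> x\<^sup>2" "0 < x\<^sup>2" using e zero_le_power2[of w] by linarith+
      then show ?thesis by (auto simp: abs_le_square_iff[symmetric])
    qed
    have finE: "finite E"
    proof (rule finite_subset)
      show "E \<subseteq> {-\<lfloor>K\<rfloor>..\<lfloor>K\<rfloor>} \<times> {-\<lfloor>K\<rfloor>..\<lfloor>K\<rfloor>}"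
      proof
        fix z assume z: "z \<in> E"
        obtain x w where [simp]: "z = (x, w)" by (cases z)
        have "\<bar>x\<bar> \<le> \<lfloor>K\<rfloor>" using z by (simp add: E_def le_floor_iff)
        then show "z \<in> {-\<lfloor>K\<rfloor>..\<lfloor>K\<rfloor>} \<times> {-\<lfloor>K\<rfloor>..\<lfloor>K\<rfloor>}" using Epos[of x w] z by auto
      qed
    qed simp
    have gap: "5 * x \<le> 4 * y" if xy: "x \<in> A" "y \<in> A" "x < y" for x y
    proof -
      obtain x1 w1 where 1: "(x1, w1) \<in> E" "x = \<bar>x1\<bar>" using xy(1) by (force simp: A_def)
      obtain x2 w2 where 2: "(x2, w2) \<in> E" "y = \<bar>x2\<bar>" using xy(2) by (force simp: A_def)
      show ?thesis
      proof (rule norm_one_gap[OF D, of x "\<bar>w1\<bar>" y "\<bar>w2\<bar>"])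
        show "x\<^sup>2 - D * \<bar>w1\<bar>\<^sup>2 = 4" "y\<^sup>2 - D * \<bar>w2\<bar>\<^sup>2 = 4" using 1 2 by (auto simp: E_def D_def)
        show "0 < x" "0 < y" using Epos 1 2 by fastforce+
      qed (use xy in auto)
    qed
    have cA: "real (card A) \<le> 1 + log (5/4) K"
    proof (cases "A = {}")
      case True
      then show ?thesis using L0 by simp
    next
      case False
      show ?thesis
      proof (rule card_geometric_gaps[OF False _ gap])
        fix x assume "x \<in> A"
        then show "1 \<le> x \<and> real_of_int x \<le> K" using Epos by (fastforce simp: A_def E_def)
      qed
    qed
    have "real (card E) \<le> real (card A) * 4"
    proof (rule card_le_fibres[where f = "\<lambda>z. \<bar>fst z\<bar>"])
      show "finite A" using finE by (simp add: A_def)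
      fix a assume a: "a \<in> A"
      then obtain x0 w0 where 0: "(x0, w0) \<in> E" "a = \<bar>x0\<bar>" by (force simp: A_def)
      let ?F = "{z \<in> E. \<bar>fst z\<bar> = a}"
      have sub: "?F \<subseteq> {x0, -x0} \<times> {w0, -w0}"
      proof
        fix z assume z: "z \<in> ?F"
        obtain x w where [simp]: "z = (x, w)" by (cases z)
        have x: "\<bar>x\<bar> = \<bar>x0\<bar>" using z 0 by simp
        then have "x\<^sup>2 = x0\<^sup>2" using power2_abs by metis
        moreover have "x\<^sup>2 + d * w\<^sup>2 = 4" "x0\<^sup>2 + d * w0\<^sup>2 = 4" using z 0 by (auto simp: E_def)
        ultimately have "d * w\<^sup>2 = d * w0\<^sup>2" by linarith
        then have "w\<^sup>2 = w0\<^sup>2" using d by simp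
        then show "z \<in> {x0, -x0} \<times> {w0, -w0}" using x by (auto simp: power2_eq_iff)
      qed
      have "card ?F \<le> card ({x0, -x0} \<times> {w0, -w0})" by (rule card_mono[OF _ sub]) simp
      also have "\<dots> \<le> 2 * 2" unfolding card_cartesian_product
        by (intro mult_le_mono) (auto simp: card_insert_if)
      finally show "real (card ?F) \<le> 4" by simp
    qed (auto simp: A_def)
    then show ?thesis using finE cA by simp
  qed
  then show "finite E" "real (card E) \<le> 25 + 4 * (1 + log (5/4) K)" by auto
qed

section \<open>The divisor bound\<close>

definition divisor_number :: "int \<Rightarrow> nat" where
  "divisor_number n = card {e :: nat. int e dvd n}"

lemma finite_divisors: "n \<noteq> 0 \<Longrightarrow> finite {e :: nat. int e dvd n}"
proof -
  assume "n \<noteq> 0"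
  then have "finite {e. e dvd nat \<bar>n\<bar>}" by (intro finite_divisors_nat) simp
  then show ?thesis by simp
qed

lemma divisor_number_prime_power_mult:
  fixes q m :: nat
  assumes "Factorial_Ring.prime q" "m > 0" "\<not> q dvd m"
  shows "divisor_number (int (q ^ a * m)) \<le> (a + 1) * divisor_number (int m)"
proof -
  have "{e. e dvd q ^ a * m} \<subseteq> (\<lambda>(i, d). q ^ i * d) ` ({..a} \<times> {d. d dvd m})"
  proof
    fix e assume "e \<in> {e. e dvd q ^ a * m}"
    then obtain b c where bc: "e = b * c" "b dvd q ^ a" "c dvd m"
      using division_decomp by blast
    then obtain i where "i \<le> a" "b = q ^ i" using divides_primepow_nat[OF assms(1)] by auto
    then show "e \<in> (\<lambda>(i, d). q ^ i * d) ` ({..a} \<times> {d. d dvd m})" using bc by force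
  qed
  moreover have fin: "finite ({..a} \<times> {d. d dvd m})" using assms(2) by simp
  ultimately have "card {e. e dvd q ^ a * m} \<le> card ((\<lambda>(i, d). q ^ i * d) ` ({..a} \<times> {d. d dvd m}))"
    by (intro card_mono) auto
  also have "\<dots> \<le> card ({..a} \<times> {d. d dvd m})" using fin by (rule card_image_le)
  finally show ?thesis by (simp add: divisor_number_def card_cartesian_product del: of_nat_mult)
qed

text \<open>
  The constant must serve all exponents at once: it is the price that each small prime pays in the
  divisor bound.
\<close>

lemma linear_le_exponential:
  fixes \<eta> :: real
  assumes "\<eta> > 0"
  obtains C :: real where "C \<ge> 1" "\<And>a :: nat. real a + 1 \<le> C * 2 powr (real a * \<eta>)"
proof
  define c where "c = \<eta> * ln 2"
  have c: "c > 0" using assms by (simp add: c_def)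
  show "1 + 1 / c \<ge> 1" using c by simp
  fix a :: nat
  have "1 + real a * c \<le> exp (real a * c)" using exp_ge_add_one_self by blast
  also have "exp (real a * c) = 2 powr (real a * \<eta>)" by (simp add: powr_def c_def mult_ac)
  finally have e: "1 + real a * c \<le> 2 powr (real a * \<eta>)" .
  have "real a + 1 \<le> (1 + 1 / c) * (1 + real a * c)"
    using c by (simp add: field_simps)
  also have "\<dots> \<le> (1 + 1 / c) * 2 powr (real a * \<eta>)" using e c by (intro mult_left_mono) auto
  finally show "real a + 1 \<le> (1 + 1 / c) * 2 powr (real a * \<eta>)" .
qed

text \<open>
  The classical product argument. If q^a exactly divides n, it contributes the factor
  (a + 1) / q^(a \<eta>) to the quotient of the number of divisors by n^\<eta>. Once q \<ge> 2^(1/\<eta>) this factor is at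
  most (a + 1) / 2^a \<le> 1; for the boundedly many smaller primes it is at most a constant C. Thus C^Q
  works, where Q bounds the small primes.
\<close>

lemma divisor_bound:
  fixes \<eta> :: real
  assumes "\<eta> > 0"
  obtains C :: real where "C > 0"
    "\<And>n :: int. n \<noteq> 0 \<Longrightarrow> real (divisor_number n) \<le> C * real_of_int \<bar>n\<bar> powr \<eta>"
proof -
  obtain C where C: "C \<ge> 1" "\<And>a :: nat. real a + 1 \<le> C * 2 powr (real a * \<eta>)"
    using linear_le_exponential[OF assms] by blast
  obtain Q :: nat where "2 powr (1 / \<eta>) < real Q" using reals_Archimedean2 by blast
  then have Q: "2 \<le> real q powr \<eta>" if "q \<ge> Q" for q
  proof -
    have "2 powr (1 / \<eta>) \<le> real q" using \<open>2 powr (1 / \<eta>) < real Q\<close> that by linarith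
    then have "(2 powr (1 / \<eta>)) powr \<eta> \<le> real q powr \<eta>" using assms by (intro powr_mono2) auto
    then show ?thesis using assms by (simp add: powr_powr)
  qed
  \<comment> \<open>Strong induction, removing the full power of one prime; the exponent of C counts small primes.\<close>
  have main: "real (divisor_number (int n)) \<le> C ^ card {q. Factorial_Ring.prime q \<and> q dvd n \<and> q < Q} * real n powr \<eta>"
    if "n > 0" for n :: nat
    using that
  proof (induction n rule: less_induct)
    case (less n)
    show ?case
    proof (cases "n = 1")
      case True
      have "{e :: nat. int e dvd 1} = {1}" by (auto simp: zdvd1_eq)
      then have "divisor_number 1 = 1" by (simp add: divisor_number_def)
      then show ?thesis using True C(1) by (simp add: one_le_power)
    next
      case False
      then obtain q where q: "Factorial_Ring.prime q" "q dvd n" using prime_factor_nat by blast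
      obtain a m where am: "n = q ^ a * m" "\<not> q dvd m"
        using multiplicity_decompose'[of n q] less.prems q
        by (metis not_prime_unit not_gr_zero)
      have m: "m > 0" "a > 0" using am less.prems q(2) by (auto intro: Nat.gr0I)
      have q1: "q > 1" using q(1) prime_gt_1_nat by blast
      have "m < n" using am(1) m one_less_power[OF q1 m(2)] by simp
      define S where "S k = {r. Factorial_Ring.prime r \<and> r dvd k \<and> r < Q}" for k
      have finS: "finite (S k)" for k by (rule finite_subset[of _ "{..<Q}"]) (auto simp: S_def)
      have step: "(real a + 1) * C ^ card (S m) \<le> C ^ card (S n) * real (q ^ a) powr \<eta>"
      proof (cases "q < Q")
        case True
        have "insert q (S m) \<subseteq> S n" using q True am by (auto simp: S_def)
        then have "card (insert q (S m)) \<le> card (S n)" using finS by (intro card_mono)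
        moreover have "q \<notin> S m" using am by (simp add: S_def)
        ultimately have cc: "Suc (card (S m)) \<le> card (S n)" using finS by simp
        have "real a + 1 \<le> C * 2 powr (real a * \<eta>)" by (rule C(2))
        also have "\<dots> = C * (2 ^ a) powr \<eta>" by (simp add: powr_powr powr_realpow[symmetric])
        also have "\<dots> \<le> C * real (q ^ a) powr \<eta>"
          using C(1) assms q1 by (intro mult_left_mono powr_mono2) (auto intro: power_mono)
        finally have "(real a + 1) * C ^ card (S m) \<le> C * real (q ^ a) powr \<eta> * C ^ card (S m)"
          using C(1) by (intro mult_right_mono) auto
        also have "\<dots> = C ^ Suc (card (S m)) * real (q ^ a) powr \<eta>" by simp
        also have "\<dots> \<le> C ^ card (S n) * real (q ^ a) powr \<eta>"
          using C(1) cc by (intro mult_right_mono power_increasing) auto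
        finally show ?thesis .
      next
        case False
        have "real a + 1 \<le> 2 ^ a" by (induction a) auto
        also have "\<dots> \<le> (real q powr \<eta>) ^ a" using Q[of q] False by (intro power_mono) auto
        also have "\<dots> = real (q ^ a) powr \<eta>" using q1
          by (simp add: powr_powr powr_realpow[symmetric] mult.commute)
        finally have "(real a + 1) * C ^ card (S m) \<le> real (q ^ a) powr \<eta> * C ^ card (S m)"
          using C(1) by (intro mult_right_mono) auto
        also have "\<dots> \<le> real (q ^ a) powr \<eta> * C ^ card (S n)"
        proof (intro mult_left_mono power_increasing)
          show "card (S m) \<le> card (S n)" using finS am by (intro card_mono) (auto simp: S_def)
        qed (use C in auto)
        finally show ?thesis by (simp add: mult.commute)
      qed
      have "real (divisor_number (int n)) \<le> (real a + 1) * real (divisor_number (int m))"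
        using divisor_number_prime_power_mult[OF q(1) m(1) am(2), of a] am(1)
        by (metis of_nat_1 of_nat_add of_nat_le_iff of_nat_mult)
      also have "\<dots> \<le> (real a + 1) * (C ^ card (S m) * real m powr \<eta>)"
        using less.IH[OF \<open>m < n\<close> m(1)] by (intro mult_left_mono) (auto simp: S_def)
      also have "\<dots> = ((real a + 1) * C ^ card (S m)) * real m powr \<eta>" by simp
      also have "\<dots> \<le> (C ^ card (S n) * real (q ^ a) powr \<eta>) * real m powr \<eta>"
        using step by (intro mult_right_mono) auto
      also have "\<dots> = C ^ card (S n) * real n powr \<eta>" using am(1) by (simp add: powr_mult)
      finally show ?thesis by (simp add: S_def)
    qed
  qed
  show ?thesis
  proof
    show "C ^ Q > 0" using C(1) by simp
    fix n :: int assume n: "n \<noteq> 0"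
    have "divisor_number n = divisor_number (int (nat \<bar>n\<bar>))" by (simp add: divisor_number_def)
    then have "real (divisor_number n)
        \<le> C ^ card {q. Factorial_Ring.prime q \<and> q dvd nat \<bar>n\<bar> \<and> q < Q} * real (nat \<bar>n\<bar>) powr \<eta>"
      using main[of "nat \<bar>n\<bar>"] n by simp
    also have "\<dots> \<le> C ^ Q * real (nat \<bar>n\<bar>) powr \<eta>"
    proof (intro mult_right_mono power_increasing)
      have "card {q. Factorial_Ring.prime q \<and> q dvd nat \<bar>n\<bar> \<and> q < Q} \<le> card {..<Q}" by (intro card_mono) auto
      then show "card {q. Factorial_Ring.prime q \<and> q dvd nat \<bar>n\<bar> \<and> q < Q} \<le> Q" by simp
    qed (use C in auto)
    finally show "real (divisor_number n) \<le> C ^ Q * real_of_int \<bar>n\<bar> powr \<eta>" by simp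
  qed
qed

section \<open>Integral points on x^2 + d y^2 = n\<close>

lemma conic_coprime_right:
  fixes x y d n :: int
  assumes "x\<^sup>2 + d * y\<^sup>2 = n" "coprime x y"
  shows "coprime y n"
proof -
  have "coprime y (x\<^sup>2)" using assms(2) by (simp add: coprime_commute)
  moreover have "gcd y n = gcd y (x\<^sup>2)"
  proof -
    have "n = x\<^sup>2 + (d * y) * y" using assms(1) by (simp add: power2_eq_square)
    then show ?thesis by (metis gcd_add_mult gcd.commute add.commute)
  qed
  ultimately show ?thesis by (simp add: coprime_iff_gcd_eq_1)
qed

text \<open>
  For a solution (x, y), the product of x Y0 - X0 y and x Y0 + X0 y is n (Y0^2 - y^2). So the gcd a of
  the first factor with n determines x / y modulo a (it is X0 / Y0) and modulo n / a (it is -X0 / Y0).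
  Two solutions with the same a therefore have the same ratio modulo lcm(a, n/a) = n / h up to sign,
  where h = gcd(a, n/a). The factor h lost here is harmless: it divides 2 X1, and its square divides
  n = a (n / a), so h^2 divides 4 d Y1^2 and hence 4 d; thus h can be absorbed by shrinking d. This
  replaces a count of the square roots of -d modulo n.
\<close>

lemma conic_class_dvd:
  fixes d n X0 Y0 X1 Y1 X2 Y2 a :: int
  assumes n: "n \<noteq> 0"
    and e: "X0\<^sup>2 + d * Y0\<^sup>2 = n" "X1\<^sup>2 + d * Y1\<^sup>2 = n" "X2\<^sup>2 + d * Y2\<^sup>2 = n"
    and c: "coprime X0 Y0" "coprime X1 Y1" "coprime X2 Y2"
    and a: "gcd (X1 * Y0 - X0 * Y1) n = a" "gcd (X2 * Y0 - X0 * Y2) n = a"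
  defines "h \<equiv> gcd a (n div a)"
  shows "h \<noteq> 0" and "h\<^sup>2 dvd 4 * d" and "n dvd h * (X1 * Y2 - X2 * Y1)"
proof -
  define b where "b = n div a"
  have "a dvd n" using a by auto
  then have ab: "n = a * b" by (simp add: b_def)
  then have a0: "a \<noteq> 0" "b \<noteq> 0" using n by auto
  show h0: "h \<noteq> 0" using a0 by (simp add: h_def)
  have other: "b dvd x * Y0 + X0 * y"
    if xy: "x\<^sup>2 + d * y\<^sup>2 = n" "gcd (x * Y0 - X0 * y) n = a" for x y
  proof -
    have "(x * Y0 - X0 * y) * (x * Y0 + X0 * y) = (x\<^sup>2 + d * y\<^sup>2) * Y0\<^sup>2 - (X0\<^sup>2 + d * Y0\<^sup>2) * y\<^sup>2"
      by (simp add: power2_eq_square algebra_simps)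
    also have "\<dots> = n * (Y0\<^sup>2 - y\<^sup>2)" using xy e(1) by (simp add: algebra_simps)
    finally have "n dvd (x * Y0 - X0 * y) * (x * Y0 + X0 * y)" by simp
    moreover obtain m where m: "x * Y0 - X0 * y = a * m" using xy(2) by (metis dvd_def gcd_dvd1)
    ultimately have "b dvd m * (x * Y0 + X0 * y)" using ab a0 by (simp add: mult.assoc)
    moreover have "coprime b m"
    proof -
      have "\<bar>a\<bar> * gcd m b = \<bar>a\<bar>"
        using xy(2) unfolding m ab by (metis gcd_mult_distrib_int abs_gcd_int abs_mult)
      then have "gcd m b = 1" using a0 by simp
      then show ?thesis by (simp add: coprime_iff_gcd_eq_1 gcd.commute)
    qed
    ultimately show ?thesis by (simp add: coprime_dvd_mult_right_iff)
  qed
  have b1: "b dvd X1 * Y0 + X0 * Y1" and b2: "b dvd X2 * Y0 + X0 * Y2"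
    using other e a by auto
  have a1: "a dvd X1 * Y0 - X0 * Y1" and a2: "a dvd X2 * Y0 - X0 * Y2"
    using a by (metis gcd_dvd1)+
  have cn: "coprime Y0 n" "coprime Y1 n" using conic_coprime_right e c by blast+
  have hab: "h dvd a" "h dvd b" by (auto simp: h_def b_def)
  then have hn: "h dvd n" "h\<^sup>2 dvd n" using ab by (auto simp: power2_eq_square mult_dvd_mono)
  \<comment> \<open>Adding both congruences shows that h divides 2 X1.\<close>
  have "h dvd (X1 * Y0 - X0 * Y1) + (X1 * Y0 + X0 * Y1)"
    using a1 b1 hab by (meson dvd_add dvd_trans)
  then have "h dvd Y0 * (2 * X1)" by (simp add: algebra_simps)
  moreover have "coprime h Y0" using cn hn by (metis coprime_commute coprime_divisors dvd_refl)
  ultimately have "h dvd 2 * X1" by (simp add: coprime_dvd_mult_right_iff)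
  then have "h\<^sup>2 dvd (2 * X1)\<^sup>2" by (rule dvd_power_same)
  then have "h\<^sup>2 dvd 4 * n - (2 * X1)\<^sup>2" using hn by (intro dvd_diff) auto
  also have "4 * n - (2 * X1)\<^sup>2 = Y1\<^sup>2 * (4 * d)" unfolding e(2)[symmetric] by (simp add: algebra_simps)
  finally have "h\<^sup>2 dvd Y1\<^sup>2 * (4 * d)" .
  moreover have "coprime (h\<^sup>2) (Y1\<^sup>2)"
    using cn hn by (metis coprime_commute coprime_divisors dvd_refl coprime_power_left_iff coprime_power_right_iff)
  ultimately show "h\<^sup>2 dvd 4 * d" by (simp add: coprime_dvd_mult_right_iff)
  define W where "W = X1 * Y2 - X2 * Y1"
  have "a dvd Y0 * W"
  proof -
    have "Y0 * W = (X1 * Y0 - X0 * Y1) * Y2 - (X2 * Y0 - X0 * Y2) * Y1"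
      by (simp add: W_def algebra_simps)
    then show ?thesis using a1 a2 by simp
  qed
  moreover have "coprime a Y0" using cn \<open>a dvd n\<close> by (metis coprime_commute coprime_divisors dvd_refl)
  ultimately have "a dvd W" by (simp add: coprime_dvd_mult_right_iff)
  have "b dvd Y0 * W"
  proof -
    have "Y0 * W = (X1 * Y0 + X0 * Y1) * Y2 - (X2 * Y0 + X0 * Y2) * Y1"
      by (simp add: W_def algebra_simps)
    then show ?thesis using b1 b2 by simp
  qed
  moreover have "coprime b Y0" using cn ab by (metis coprime_commute coprime_divisors dvd_refl dvd_triv_right)
  ultimately have "b dvd W" by (simp add: coprime_dvd_mult_right_iff)
  \<comment> \<open>A common multiple of a and b is divisible by a b after multiplication by their gcd h.\<close>
  have "a * b dvd a * W" "a * b dvd b * W" using \<open>a dvd W\<close> \<open>b dvd W\<close> by auto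
  then have "n dvd gcd (a * W) (b * W)" using ab by simp
  also have "gcd (a * W) (b * W) = \<bar>W\<bar> * h"
    by (simp add: h_def b_def[symmetric] gcd_mult_distrib_int mult.commute abs_mult)
  finally show "n dvd h * (X1 * Y2 - X2 * Y1)" unfolding W_def[symmetric]
    by (metis abs_gcd_int abs_mult dvd_abs_iff h_def mult.commute)
qed

lemma log_cube_nonneg:
  fixes B :: real
  assumes "B \<ge> 1"
  shows "0 \<le> log (5/4) (4 * B ^ 3)"
proof -
  have "1 \<le> B ^ 3" using assms by (rule one_le_power)
  then have "1 \<le> 4 * B ^ 3" by linarith
  then show ?thesis by (intro iffD2[OF zero_le_log_cancel_iff]) linarith+
qed

text \<open>
  Fix one solution (X2, Y2) of the class and divide all others by it in Q(sqrt(-d)). The quotient is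
  (V - W sqrt(-d)) / n of norm 1; since n divides h W and h^2 divides 4 d, it can be written as
  (\<alpha> - w sqrt(-d')) / 2 with integers \<alpha>, w and d' = 4 d / h^2. So the class is no larger than
  the number of norm-one elements of bounded size.
\<close>

lemma card_conic_class:
  fixes d n X0 Y0 a :: int and B :: real
  assumes n: "n \<noteq> 0" and d: "d \<noteq> 0" and B: "B \<ge> 1" "real_of_int \<bar>d\<bar> \<le> B"
    and e0: "X0\<^sup>2 + d * Y0\<^sup>2 = n" "coprime X0 Y0"
    and F: "\<And>x y. (x, y) \<in> F \<Longrightarrow> x\<^sup>2 + d * y\<^sup>2 = n \<and> coprime x y \<and>
      real_of_int \<bar>x\<bar> \<le> B \<and> real_of_int \<bar>y\<bar> \<le> B \<and> gcd (x * Y0 - X0 * y) n = a"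
  shows "finite F" and "real (card F) \<le> 25 + 4 * (1 + log (5/4) (4 * B ^ 3))"
proof -
  have "finite F \<and> real (card F) \<le> 25 + 4 * (1 + log (5/4) (4 * B ^ 3))"
  proof (cases "F = {}")
    case True
    show ?thesis using True log_cube_nonneg[OF B(1)] by simp
  next
    case False
    then obtain X2 Y2 where 2: "(X2, Y2) \<in> F" by (metis ex_in_conv surj_pair)
    define h where "h = gcd a (n div a)"
    note F2 = F[OF 2]
    note cls = conic_class_dvd[OF n e0(1) _ _ e0(2), of _ _ X2 Y2 a, folded h_def]
    have h0: "h \<noteq> 0" and h4: "h\<^sup>2 dvd 4 * d" using cls(1,2)[of X2 Y2] F2 by auto
    obtain d' where d': "4 * d = h\<^sup>2 * d'" using h4 by blast
    then have d'0: "d' \<noteq> 0" using d by auto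
    define V where "V = (\<lambda>(x, y). x * X2 + d * y * Y2)"
    define W where "W = (\<lambda>(x, y). x * Y2 - X2 * y)"
    define \<phi> where "\<phi> = (\<lambda>z. (2 * V z div n, h * W z div n))"
    have ex: "n * fst (\<phi> z) = 2 * V z \<and> n * snd (\<phi> z) = h * W z \<and>
        (fst (\<phi> z))\<^sup>2 + d' * (snd (\<phi> z))\<^sup>2 = 4" if z: "z \<in> F" for z
    proof -
      obtain x y where [simp]: "z = (x, y)" by (cases z)
      note F1 = F[OF z[simplified]]
      have "n dvd h * W z" using cls(3)[of x y] F1 F2 by (simp add: W_def)
      then obtain w where w: "h * W z = n * w" by blast
      have "(V z)\<^sup>2 + d * (W z)\<^sup>2 = (x\<^sup>2 + d * y\<^sup>2) * (X2\<^sup>2 + d * Y2\<^sup>2)"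
        by (simp add: V_def W_def power2_eq_square algebra_simps)
      then have norm: "(V z)\<^sup>2 + d * (W z)\<^sup>2 = n\<^sup>2" using F1 F2 by (simp add: power2_eq_square)
      have "(2 * V z)\<^sup>2 = 4 * n\<^sup>2 - (4 * d) * (W z)\<^sup>2"
        using norm by (simp add: power_mult_distrib)
      also have "(4 * d) * (W z)\<^sup>2 = d' * (h * W z)\<^sup>2" unfolding d' by (simp add: power_mult_distrib)
      also have "\<dots> = d' * w\<^sup>2 * n\<^sup>2" unfolding w by (simp add: power_mult_distrib)
      finally have eq: "(2 * V z)\<^sup>2 = n\<^sup>2 * (4 - d' * w\<^sup>2)" by (simp add: algebra_simps)
      \<comment> \<open>The first coordinate is integral because its square is an integer.\<close>
      then have "n\<^sup>2 dvd (2 * V z)\<^sup>2" by simp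
      then have "n dvd 2 * V z" by (simp only: pow_divides_pow_iff zero_less_numeral)
      then obtain \<alpha> where \<alpha>: "2 * V z = n * \<alpha>" by blast
      have "n\<^sup>2 * \<alpha>\<^sup>2 = n\<^sup>2 * (4 - d' * w\<^sup>2)" using eq unfolding \<alpha> by (simp add: power_mult_distrib)
      then have "\<alpha>\<^sup>2 + d' * w\<^sup>2 = 4" using n by simp
      moreover have "\<phi> z = (\<alpha>, w)" using \<alpha> w n by (simp add: \<phi>_def)
      ultimately show ?thesis using \<alpha> w by simp
    qed
    have inj: "inj_on \<phi> F"
    proof (rule inj_onI)
      fix z z' assume z: "z \<in> F" "z' \<in> F" "\<phi> z = \<phi> z'"
      have "2 * V z = 2 * V z'" "h * W z = h * W z'" using ex[OF z(1)] ex[OF z(2)] z(3) by auto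
      then have VW: "V z = V z'" "W z = W z'" using h0 by auto
      \<comment> \<open>Multiplying the quotient by the fixed solution gives back the point.\<close>
      have recover: "n * fst z = X2 * V z + d * Y2 * W z \<and> n * snd z = Y2 * V z - X2 * W z" for z
      proof -
        have n2: "n = X2\<^sup>2 + d * Y2\<^sup>2" using F2 by simp
        show ?thesis
          unfolding n2 V_def W_def case_prod_beta by (simp add: power2_eq_square algebra_simps)
      qed
      have "n * fst z = n * fst z'" "n * snd z = n * snd z'"
        using recover[of z] recover[of z'] VW by simp_all
      then show "z = z'" using n by (simp add: prod_eq_iff)
    qed
    define E where "E = {(x, w). x\<^sup>2 + d' * w\<^sup>2 = 4 \<and> real_of_int \<bar>x\<bar> \<le> 4 * B ^ 3}"
    have sub: "\<phi> ` F \<subseteq> E"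
    proof
      fix v assume "v \<in> \<phi> ` F"
      then obtain z where z: "z \<in> F" "v = \<phi> z" by blast
      obtain x y where [simp]: "z = (x, y)" by (cases z)
      note F1 = F[OF z(1)[simplified]]
      have "\<bar>V z\<bar> \<le> \<bar>x\<bar> * \<bar>X2\<bar> + \<bar>d\<bar> * \<bar>y\<bar> * \<bar>Y2\<bar>"
        by (simp add: V_def) (metis abs_mult abs_triangle_ineq)
      then have "real_of_int \<bar>V z\<bar> \<le> real_of_int (\<bar>x\<bar> * \<bar>X2\<bar> + \<bar>d\<bar> * \<bar>y\<bar> * \<bar>Y2\<bar>)" by (simp only: of_int_le_iff)
      also have "\<dots> = real_of_int \<bar>x\<bar> * real_of_int \<bar>X2\<bar> + real_of_int \<bar>d\<bar> * real_of_int \<bar>y\<bar> * real_of_int \<bar>Y2\<bar>"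
        by simp
      also have "\<dots> \<le> B * B + B * B * B"
        using F1 F2 B by (intro add_mono mult_mono) auto
      also have "\<dots> \<le> 2 * B ^ 3"
      proof -
        have "B * B * 1 \<le> B * B * B" using B(1) by (intro mult_left_mono) auto
        then show ?thesis by (simp add: power3_eq_cube)
      qed
      finally have "real_of_int \<bar>2 * V z\<bar> \<le> 4 * B ^ 3" by simp
      moreover have "\<bar>fst (\<phi> z)\<bar> \<le> \<bar>2 * V z\<bar>"
      proof -
        have "1 * \<bar>fst (\<phi> z)\<bar> \<le> \<bar>n\<bar> * \<bar>fst (\<phi> z)\<bar>" using n by (intro mult_right_mono) auto
        also have "\<dots> = \<bar>2 * V z\<bar>" using ex[OF z(1)] by (metis abs_mult)
        finally show ?thesis by simp
      qed
      ultimately have "real_of_int \<bar>fst (\<phi> z)\<bar> \<le> 4 * B ^ 3" by linarith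
      then show "v \<in> E" using ex[OF z(1)] z(2) unfolding E_def by (simp add: case_prod_beta)
    qed
    have "1 \<le> B ^ 3" using B(1) by (rule one_le_power)
    then have K: "4 * B ^ 3 \<ge> 1" by linarith
    note EE = card_norm_one_elements[OF d'0 K, folded E_def]
    have "card F \<le> card E" using card_inj_on_le[OF inj sub EE(1)] .
    moreover have "finite F" using inj sub EE(1) by (meson finite_subset finite_imageD)
    ultimately show ?thesis using EE(2) by linarith
  qed
  then show "finite F" "real (card F) \<le> 25 + 4 * (1 + log (5/4) (4 * B ^ 3))" by auto
qed

lemma card_conic_coprime:
  fixes d n :: int and B :: real
  assumes n: "n \<noteq> 0" and d: "d \<noteq> 0" and B: "B \<ge> 1" "real_of_int \<bar>d\<bar> \<le> B"
  defines "S \<equiv> {(x, y). x\<^sup>2 + d * y\<^sup>2 = n \<and> coprime x y \<and>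
      real_of_int \<bar>x\<bar> \<le> B \<and> real_of_int \<bar>y\<bar> \<le> B}"
  shows "real (card S) \<le> real (divisor_number n) * (25 + 4 * (1 + log (5/4) (4 * B ^ 3)))"
proof (cases "S = {}")
  case True
  show ?thesis using True log_cube_nonneg[OF B(1)] by simp
next
  case False
  then obtain X0 Y0 where "(X0, Y0) \<in> S" by (metis ex_in_conv surj_pair)
  then have e0: "X0\<^sup>2 + d * Y0\<^sup>2 = n" "coprime X0 Y0" by (auto simp: S_def)
  define g where "g z = nat (gcd (fst z * Y0 - X0 * snd z) n)" for z
  have cls: "finite {z \<in> S. g z = i} \<and>
      real (card {z \<in> S. g z = i}) \<le> 25 + 4 * (1 + log (5/4) (4 * B ^ 3))" for i
  proof -
    have F: "x\<^sup>2 + d * y\<^sup>2 = n \<and> coprime x y \<and>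
      real_of_int \<bar>x\<bar> \<le> B \<and> real_of_int \<bar>y\<bar> \<le> B \<and> gcd (x * Y0 - X0 * y) n = int i"
      if "(x, y) \<in> {z \<in> S. g z = i}" for x y using that by (auto simp: S_def g_def)
    show ?thesis using card_conic_class[OF n d B e0 F] by blast
  qed
  show ?thesis unfolding divisor_number_def
  proof (rule card_le_fibres)
    show "finite {e. int e dvd n}" by (rule finite_divisors[OF n])
    show "g ` S \<subseteq> {e. int e dvd n}" by (auto simp: g_def)
  qed (use cls in auto)
qed

text \<open>
  Divide each point by the gcd e of its coordinates. Then e^2 divides n and the quotient is a coprime
  solution for n / e^2, so at most one more factor for the number of divisors arises.
\<close>

lemma card_conic_points:
  fixes d n :: int and B :: real
  assumes n: "n \<noteq> 0" and d: "d \<noteq> 0" and B: "B \<ge> 1" "real_of_int \<bar>d\<bar> \<le> B"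
  defines "S \<equiv> {(x, y). x\<^sup>2 + d * y\<^sup>2 = n \<and> real_of_int \<bar>x\<bar> \<le> B \<and> real_of_int \<bar>y\<bar> \<le> B}"
  shows "finite S"
    and "real (card S) \<le> (real (divisor_number n))\<^sup>2 * (25 + 4 * (1 + log (5/4) (4 * B ^ 3)))"
proof -
  define U where "U = 25 + 4 * (1 + log (5/4) (4 * B ^ 3))"
  have U0: "U \<ge> 0" using log_cube_nonneg[OF B(1)] by (simp add: U_def)
  have box: "finite {z :: int \<times> int. real_of_int \<bar>fst z\<bar> \<le> B \<and> real_of_int \<bar>snd z\<bar> \<le> B}"
  proof (rule finite_subset)
    show "{z :: int \<times> int. real_of_int \<bar>fst z\<bar> \<le> B \<and> real_of_int \<bar>snd z\<bar> \<le> B}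
        \<subseteq> {-\<lfloor>B\<rfloor>..\<lfloor>B\<rfloor>} \<times> {-\<lfloor>B\<rfloor>..\<lfloor>B\<rfloor>}"
    proof
      fix z :: "int \<times> int" assume "z \<in> {z. real_of_int \<bar>fst z\<bar> \<le> B \<and> real_of_int \<bar>snd z\<bar> \<le> B}"
      then have "\<bar>fst z\<bar> \<le> \<lfloor>B\<rfloor>" "\<bar>snd z\<bar> \<le> \<lfloor>B\<rfloor>" by (simp_all add: le_floor_iff)
      then show "z \<in> {-\<lfloor>B\<rfloor>..\<lfloor>B\<rfloor>} \<times> {-\<lfloor>B\<rfloor>..\<lfloor>B\<rfloor>}" by (auto simp: mem_Times_iff)
    qed
  qed simp
  show finS: "finite S" by (rule finite_subset[OF _ box]) (auto simp: S_def)
  define P where "P m = {(x, y). x\<^sup>2 + d * y\<^sup>2 = m \<and> coprime x y \<and>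
      real_of_int \<bar>x\<bar> \<le> B \<and> real_of_int \<bar>y\<bar> \<le> B}" for m
  have finP: "finite (P m)" for m by (rule finite_subset[OF _ box]) (auto simp: P_def)
  define g where "g z = nat (gcd (fst z) (snd z))" for z :: "int \<times> int"
  have sq: "int (g z) ^ 2 dvd n \<and> g z \<noteq> 0 \<and>
      (fst z div int (g z), snd z div int (g z)) \<in> P (n div (int (g z))\<^sup>2)" if z: "z \<in> S" for z
  proof -
    obtain x y where [simp]: "z = (x, y)" by (cases z)
    define e where "e = gcd x y"
    have eg: "int (g z) = e" by (simp add: g_def e_def)
    have eq: "x\<^sup>2 + d * y\<^sup>2 = n" using z by (simp add: S_def)
    then have "x \<noteq> 0 \<or> y \<noteq> 0" using n by auto
    then have e0: "e > 0" by (simp add: e_def)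
    obtain x' y' where xy: "x = e * x'" "y = e * y'" by (metis e_def dvd_def gcd_dvd1 gcd_dvd2)
    have div: "x div e = x'" "y div e = y'" using xy e0 by auto
    have cop: "coprime x' y'"
      using div \<open>x \<noteq> 0 \<or> y \<noteq> 0\<close> by (metis div_gcd_coprime e_def)
    have n': "n = e\<^sup>2 * (x'\<^sup>2 + d * y'\<^sup>2)" using eq by (simp add: xy power_mult_distrib algebra_simps)
    have "\<bar>x'\<bar> \<le> \<bar>x\<bar>" "\<bar>y'\<bar> \<le> \<bar>y\<bar>" using e0 by (auto simp: xy abs_mult mult_le_cancel_right1)
    then have "real_of_int \<bar>x'\<bar> \<le> B" "real_of_int \<bar>y'\<bar> \<le> B" using z by (auto simp: S_def)
    then have "(x', y') \<in> P (n div e\<^sup>2)" using n' cop e0 by (auto simp: P_def)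
    moreover have "e\<^sup>2 dvd n" using n' by simp
    ultimately show ?thesis using e0 eg div by auto
  qed
  have fib: "real (card {z \<in> S. g z = i}) \<le> real (divisor_number n) * U" for i
  proof (cases "{z \<in> S. g z = i} = {}")
    case True
    show ?thesis unfolding True using U0 by simp
  next
    case False
    then have i: "(int i)\<^sup>2 dvd n" "i \<noteq> 0" using sq by auto
    define m where "m = n div (int i)\<^sup>2"
    have mn: "m dvd n" "m \<noteq> 0" using i n by (auto simp: m_def dvd_div_eq_0_iff)
    have "inj_on (\<lambda>z. (fst z div int i, snd z div int i)) {z \<in> S. g z = i}"
    proof (rule inj_onI)
      fix z z' assume z: "z \<in> {z \<in> S. g z = i}" "z' \<in> {z \<in> S. g z = i}"
        "(fst z div int i, snd z div int i) = (fst z' div int i, snd z' div int i)"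
      have g_dvd: "int (g z) dvd fst z" "int (g z) dvd snd z" for z by (simp_all add: g_def)
      have "g z = i" "g z' = i" using z(1,2) by simp_all
      then have dv: "int i dvd fst z" "int i dvd snd z" "int i dvd fst z'" "int i dvd snd z'"
        using g_dvd[of z] g_dvd[of z'] by simp_all
      then show "z = z'" using z(3) by (metis dvd_div_mult_self fst_conv snd_conv prod_eq_iff)
    qed
    moreover have "(\<lambda>z. (fst z div int i, snd z div int i)) ` {z \<in> S. g z = i} \<subseteq> P m"
      using sq by (auto simp: m_def)
    ultimately have "card {z \<in> S. g z = i} \<le> card (P m)" using finP by (rule card_inj_on_le)
    then have "real (card {z \<in> S. g z = i}) \<le> real (card (P m))" by simp
    also have "\<dots> \<le> real (divisor_number m) * U"
      unfolding U_def P_def by (rule card_conic_coprime[OF mn(2) d B])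
    also have "\<dots> \<le> real (divisor_number n) * U"
    proof (rule mult_right_mono[OF _ U0])
      have "card {e. int e dvd m} \<le> card {e. int e dvd n}"
        using mn n by (intro card_mono finite_divisors) (auto intro: dvd_trans)
      then show "real (divisor_number m) \<le> real (divisor_number n)" by (simp add: divisor_number_def)
    qed
    finally show ?thesis .
  qed
  have "real (card S) \<le> real (divisor_number n) * (real (divisor_number n) * U)"
    unfolding divisor_number_def
  proof (rule card_le_fibres[where f = g])
    show "finite {e. int e dvd n}" by (rule finite_divisors[OF n])
    show "g ` S \<subseteq> {e. int e dvd n}"
    proof
      fix e assume "e \<in> g ` S"
      then have "(int e)\<^sup>2 dvd n" using sq by auto
      then show "e \<in> {e. int e dvd n}" by (metis dvd_mult_left mem_Collect_eq power2_eq_square)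
    qed
  qed (use finS fib in \<open>auto simp: divisor_number_def\<close>)
  then show "real (card S) \<le> (real (divisor_number n))\<^sup>2 * (25 + 4 * (1 + log (5/4) (4 * B ^ 3)))"
    by (simp add: U_def power2_eq_square mult.assoc)
qed

lemma conic_points_bound:
  fixes \<eta> :: real
  assumes \<eta>: "\<eta> > 0"
  obtains C :: real where "C > 0"
    "\<And>(d :: int) (n :: int) (B :: real). d \<noteq> 0 \<Longrightarrow> n \<noteq> 0 \<Longrightarrow> B \<ge> 1 \<Longrightarrow>
       real_of_int \<bar>d\<bar> \<le> B \<Longrightarrow> real_of_int \<bar>n\<bar> \<le> B \<Longrightarrow>
       real (card {(x, y). x\<^sup>2 + d * y\<^sup>2 = n \<and> real_of_int \<bar>x\<bar> \<le> B \<and> real_of_int \<bar>y\<bar> \<le> B})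
         \<le> C * B powr \<eta>"
proof -
  have "\<eta> / 4 > 0" using \<eta> by simp
  then obtain C where C: "C > 0"
    "\<And>n :: int. n \<noteq> 0 \<Longrightarrow> real (divisor_number n) \<le> C * real_of_int \<bar>n\<bar> powr (\<eta> / 4)"
    using divisor_bound by blast
  define L where "L = ln (5/4 :: real)"
  have L: "L > 0" by (simp add: L_def)
  define K where "K = 29 + 4 * (ln 4 / L) + 12 / L * (2 / \<eta>)"
  have K: "K > 0" unfolding K_def using L \<eta> by (intro add_pos_nonneg) auto
  show ?thesis
  proof
    show "C\<^sup>2 * K > 0" using C(1) K by simp
    fix d n :: int and B :: real
    assume a: "d \<noteq> 0" "n \<noteq> 0" "B \<ge> 1" "real_of_int \<bar>d\<bar> \<le> B" "real_of_int \<bar>n\<bar> \<le> B"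
    have B1: "1 \<le> B powr (\<eta> / 2)" using a(3) \<eta> by (simp add: ge_one_powr_ge_zero)
    have "log (5/4) (4 * B ^ 3) = ln 4 / L + 3 / L * ln B"
      using a(3) by (simp add: log_def L_def ln_mult ln_realpow add_divide_distrib)
    moreover have "ln B \<le> B powr (\<eta> / 2) / (\<eta> / 2)" using a(3) \<eta> by (intro ln_powr_bound) auto
    then have "3 / L * ln B \<le> 3 / L * (B powr (\<eta> / 2) / (\<eta> / 2))" using L by (intro mult_left_mono) auto
    ultimately have "25 + 4 * (1 + log (5/4) (4 * B ^ 3))
        \<le> (29 + 4 * (ln 4 / L)) * 1 + 12 / L * (2 / \<eta>) * B powr (\<eta> / 2)" by simp
    also have "\<dots> \<le> (29 + 4 * (ln 4 / L)) * B powr (\<eta> / 2) + 12 / L * (2 / \<eta>) * B powr (\<eta> / 2)"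
      using B1 L \<eta> by (intro add_mono mult_left_mono) auto
    also have "\<dots> = K * B powr (\<eta> / 2)" by (simp add: K_def algebra_simps)
    finally have U: "25 + 4 * (1 + log (5/4) (4 * B ^ 3)) \<le> K * B powr (\<eta> / 2)" .
    have "real (divisor_number n) \<le> C * real_of_int \<bar>n\<bar> powr (\<eta> / 4)" by (rule C(2)[OF a(2)])
    also have "\<dots> \<le> C * B powr (\<eta> / 4)" using C(1) a(5) \<eta> by (intro mult_left_mono powr_mono2) auto
    finally have "(real (divisor_number n))\<^sup>2 \<le> (C * B powr (\<eta> / 4))\<^sup>2" by (intro power_mono) auto
    also have "\<dots> = C\<^sup>2 * B powr (\<eta> / 2)"
      by (simp add: power_mult_distrib power2_eq_square powr_add[symmetric])
    finally have T: "(real (divisor_number n))\<^sup>2 \<le> C\<^sup>2 * B powr (\<eta> / 2)" .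
    have "real (card {(x, y). x\<^sup>2 + d * y\<^sup>2 = n \<and> real_of_int \<bar>x\<bar> \<le> B \<and> real_of_int \<bar>y\<bar> \<le> B})
       \<le> (real (divisor_number n))\<^sup>2 * (25 + 4 * (1 + log (5/4) (4 * B ^ 3)))"
      by (rule card_conic_points(2)[OF a(2,1,3,4)])
    also have "\<dots> \<le> (real (divisor_number n))\<^sup>2 * (K * B powr (\<eta> / 2))"
      using U by (intro mult_left_mono) auto
    also have "\<dots> \<le> (C\<^sup>2 * B powr (\<eta> / 2)) * (K * B powr (\<eta> / 2))"
      using T K by (intro mult_right_mono) auto
    also have "\<dots> = C\<^sup>2 * K * (B powr (\<eta> / 2) * B powr (\<eta> / 2))" by simp
    also have "B powr (\<eta> / 2) * B powr (\<eta> / 2) = B powr \<eta>" by (simp add: powr_add[symmetric])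
    finally show "real (card {(x, y). x\<^sup>2 + d * y\<^sup>2 = n \<and> real_of_int \<bar>x\<bar> \<le> B \<and> real_of_int \<bar>y\<bar> \<le> B})
         \<le> C\<^sup>2 * K * B powr \<eta>" .
  qed
qed

section \<open>Points of a modular conic in a small box\<close>

text \<open>
  Completing both squares turns the equation into x^2 + v1 v2 y^2 = n with
  n = v2 (4 v1 v2 k + v2 v3^2 + v1 v4^2). If some point exists in the box, k is at most 4 q^3 in absolute value,
  and then n, v1 v2, x and y are all at most q^9, so that \<open>conic_points_bound\<close> applies with B = q^9.
\<close>

lemma conic_box_bound:
  fixes \<eta> :: real
  assumes \<eta>: "\<eta> > 0"
  obtains C :: real where "C > 0"
    "\<And>q v1 v2 v3 v4 k :: int. q \<ge> 3 \<Longrightarrow> v1 \<noteq> 0 \<Longrightarrow> v2 \<noteq> 0 \<Longrightarrow>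
       4 * v1 * v2 * k + v2 * v3\<^sup>2 + v1 * v4\<^sup>2 \<noteq> 0 \<Longrightarrow>
       \<bar>v1\<bar> \<le> q \<Longrightarrow> \<bar>v2\<bar> \<le> q \<Longrightarrow> \<bar>v3\<bar> \<le> q \<Longrightarrow> \<bar>v4\<bar> \<le> q \<Longrightarrow>
       real (card {(s, t). \<bar>s\<bar> \<le> q \<and> \<bar>t\<bar> \<le> q \<and> v1 * s\<^sup>2 + v2 * t\<^sup>2 + v3 * s + v4 * t = k})
         \<le> C * real_of_int q powr \<eta>"
proof -
  have "\<eta> / 9 > 0" using \<eta> by simp
  then obtain C where C: "C > 0"
    "\<And>(d :: int) (n :: int) (B :: real). d \<noteq> 0 \<Longrightarrow> n \<noteq> 0 \<Longrightarrow> B \<ge> 1 \<Longrightarrow>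
       real_of_int \<bar>d\<bar> \<le> B \<Longrightarrow> real_of_int \<bar>n\<bar> \<le> B \<Longrightarrow>
       real (card {(x, y). x\<^sup>2 + d * y\<^sup>2 = n \<and> real_of_int \<bar>x\<bar> \<le> B \<and> real_of_int \<bar>y\<bar> \<le> B})
         \<le> C * B powr (\<eta> / 9)"
    using conic_points_bound by blast
  show ?thesis
  proof
    show "C > 0" by (rule C(1))
    fix q v1 v2 v3 v4 k :: int
    assume q: "q \<ge> 3" and v0: "v1 \<noteq> 0" "v2 \<noteq> 0"
      and nz: "4 * v1 * v2 * k + v2 * v3\<^sup>2 + v1 * v4\<^sup>2 \<noteq> 0"
      and v: "\<bar>v1\<bar> \<le> q" "\<bar>v2\<bar> \<le> q" "\<bar>v3\<bar> \<le> q" "\<bar>v4\<bar> \<le> q"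
    define S where "S = {(s, t). \<bar>s\<bar> \<le> q \<and> \<bar>t\<bar> \<le> q \<and> v1 * s\<^sup>2 + v2 * t\<^sup>2 + v3 * s + v4 * t = k}"
    define n where "n = v2 * (4 * v1 * v2 * k + v2 * v3\<^sup>2 + v1 * v4\<^sup>2)"
    \<comment> \<open>The exponent 9 is generous enough to absorb numerical factors up to 27 through q \<ge> 3.\<close>
    define B where "B = real_of_int q ^ 9"
    define E where "E = {(x, y). x\<^sup>2 + (v1 * v2) * y\<^sup>2 = n \<and> real_of_int \<bar>x\<bar> \<le> B \<and> real_of_int \<bar>y\<bar> \<le> B}"
    have toB: "real_of_int m \<le> B" if "m \<le> q ^ 9" for m
      using that unfolding B_def by (metis of_int_le_iff of_int_power)
    have pw: "m * q ^ i \<le> q ^ 9" if "m \<le> 3 ^ j" "i + j = 9" for m :: int and i j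
    proof -
      have "m \<le> q ^ j" using that(1) q by (meson order_trans power_mono zero_le_numeral)
      then have "m * q ^ i \<le> q ^ j * q ^ i" using q by (intro mult_right_mono) auto
      then show ?thesis using that(2) by (simp add: power_add[symmetric] add.commute)
    qed
    have B1: "B \<ge> 1" unfolding B_def using q by (intro one_le_power) auto
    have "real (card S) \<le> C * B powr (\<eta> / 9)"
    proof (cases "S = {}")
      case True
      then show ?thesis using C(1) by simp
    next
      case False
      have lin: "\<bar>2 * w * s + w'\<bar> \<le> 3 * q ^ 2" if "\<bar>w\<bar> \<le> q" "\<bar>w'\<bar> \<le> q" "\<bar>s\<bar> \<le> q" for w w' s
      proof -
        have "\<bar>w\<bar> * \<bar>s\<bar> \<le> q * q" using that by (intro mult_mono) auto
        moreover have "1 * q \<le> q * q" using q by (intro mult_right_mono) auto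
        moreover have "\<bar>2 * w * s + w'\<bar> \<le> 2 * (\<bar>w\<bar> * \<bar>s\<bar>) + \<bar>w'\<bar>"
          by (metis abs_triangle_ineq abs_mult abs_numeral mult.assoc)
        ultimately show ?thesis using that(2) by (simp add: power2_eq_square)
      qed
      obtain s0 t0 where st0: "\<bar>s0\<bar> \<le> q" "\<bar>t0\<bar> \<le> q" "v1 * s0\<^sup>2 + v2 * t0\<^sup>2 + v3 * s0 + v4 * t0 = k"
        using False by (auto simp: S_def)
      have sqb: "\<bar>w * s\<^sup>2\<bar> \<le> q ^ 3" if "\<bar>w\<bar> \<le> q" "\<bar>s\<bar> \<le> q" for w s
      proof -
        have "\<bar>w * s\<^sup>2\<bar> = \<bar>w\<bar> * (\<bar>s\<bar> * \<bar>s\<bar>)" by (simp add: abs_mult power2_eq_square)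
        also have "\<dots> \<le> q * (q * q)" using that q by (intro mult_mono) auto
        finally show ?thesis by (simp add: power3_eq_cube)
      qed
      have linb: "\<bar>w * s\<bar> \<le> q ^ 3" if "\<bar>w\<bar> \<le> q" "\<bar>s\<bar> \<le> q" for w s
      proof -
        have "\<bar>w * s\<bar> \<le> q * q" unfolding abs_mult using that q by (intro mult_mono) auto
        also have "\<dots> \<le> q * q * q" using q by (simp add: mult_le_cancel_left1)
        finally show ?thesis by (simp add: power3_eq_cube)
      qed
      have kb: "\<bar>k\<bar> \<le> 4 * q ^ 3"
        using st0(3) sqb[OF v(1) st0(1)] sqb[OF v(2) st0(2)] linb[OF v(3) st0(1)] linb[OF v(4) st0(2)]
        by linarith
      have "\<bar>4 * v1 * v2 * k\<bar> = 4 * (\<bar>v1\<bar> * \<bar>v2\<bar> * \<bar>k\<bar>)" by (simp add: abs_mult)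
      also have "\<dots> \<le> 4 * (q * q * (4 * q ^ 3))" using v kb q by (intro mult_left_mono mult_mono) auto
      also have "\<dots> = 16 * q ^ 5" by (simp add: eval_nat_numeral)
      finally have n1: "\<bar>4 * v1 * v2 * k\<bar> \<le> 16 * q ^ 5" .
      have "q ^ 3 \<le> q ^ 5" using q by (intro power_increasing) auto
      then have inner: "\<bar>4 * v1 * v2 * k + v2 * v3\<^sup>2 + v1 * v4\<^sup>2\<bar> \<le> 18 * q ^ 5"
        using n1 sqb[OF v(2,3)] sqb[OF v(1,4)] by linarith
      have "\<bar>n\<bar> \<le> q * (18 * q ^ 5)" unfolding n_def abs_mult using v(2) inner q by (intro mult_mono) auto
      also have "\<dots> = 18 * q ^ 6" by (simp add: eval_nat_numeral)
      also have "\<dots> \<le> q ^ 9" by (rule pw[of _ 3]) auto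
      finally have nB: "real_of_int \<bar>n\<bar> \<le> B" by (rule toB)
      have "\<bar>v1 * v2\<bar> \<le> q * q" unfolding abs_mult using v q by (intro mult_mono) auto
      also have "\<dots> = 1 * q ^ 2" by (simp add: power2_eq_square)
      also have "\<dots> \<le> q ^ 9" by (rule pw[of _ 7]) auto
      finally have dB: "real_of_int \<bar>v1 * v2\<bar> \<le> B" by (rule toB)
      define \<phi> where "\<phi> z = (v2 * (2 * v1 * fst z + v3), 2 * v2 * snd z + v4)" for z :: "int \<times> int"
      have inj: "inj_on \<phi> S" using v0 by (auto simp: inj_on_def \<phi>_def)
      have "\<phi> ` S \<subseteq> E"
      proof
        fix z assume "z \<in> \<phi> ` S"
        then obtain s t where z: "(s, t) \<in> S" "z = \<phi> (s, t)" by auto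
        then have st: "\<bar>s\<bar> \<le> q" "\<bar>t\<bar> \<le> q" "v1 * s\<^sup>2 + v2 * t\<^sup>2 + v3 * s + v4 * t = k" by (auto simp: S_def)
        have "(v2 * (2 * v1 * s + v3))\<^sup>2 + (v1 * v2) * (2 * v2 * t + v4)\<^sup>2 = n"
          unfolding n_def st(3)[symmetric] by (simp add: power2_eq_square algebra_simps)
        moreover have "real_of_int \<bar>v2 * (2 * v1 * s + v3)\<bar> \<le> B"
        proof -
          have "\<bar>v2 * (2 * v1 * s + v3)\<bar> \<le> q * (3 * q ^ 2)"
            unfolding abs_mult[of v2] using v lin[OF v(1,3) st(1)] q by (intro mult_mono) auto
          also have "\<dots> = 3 * q ^ 3" by (simp add: eval_nat_numeral)
          also have "\<dots> \<le> q ^ 9" by (rule pw[of _ 6]) auto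
          finally show ?thesis by (rule toB)
        qed
        moreover have "real_of_int \<bar>2 * v2 * t + v4\<bar> \<le> B"
        proof -
          have "\<bar>2 * v2 * t + v4\<bar> \<le> 3 * q ^ 2" by (rule lin[OF v(2,4) st(2)])
          also have "\<dots> \<le> q ^ 9" by (rule pw[of _ 7]) auto
          finally show ?thesis by (rule toB)
        qed
        ultimately show "z \<in> E" 
          unfolding E_def z(2) \<phi>_def mem_Collect_eq prod.case fst_conv snd_conv by (intro conjI)
      qed
      moreover have "finite E"
        unfolding E_def using v0 nz by (intro card_conic_points(1)[OF _ _ B1 dB]) (auto simp: n_def)
      ultimately have "card S \<le> card E" using inj by (intro card_inj_on_le)
      moreover have "real (card E) \<le> C * B powr (\<eta> / 9)"
        unfolding E_def using v0 nz by (intro C(2) B1 dB nB) (auto simp: n_def)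
      ultimately show ?thesis by linarith
    qed
    also have "B powr (\<eta> / 9) = real_of_int q powr \<eta>"
    proof -
      have "B = real_of_int q powr 9" using q by (simp add: B_def)
      then show ?thesis by (simp add: powr_powr)
    qed
    finally show "real (card {(s, t). \<bar>s\<bar> \<le> q \<and> \<bar>t\<bar> \<le> q \<and> v1 * s\<^sup>2 + v2 * t\<^sup>2 + v3 * s + v4 * t = k})
         \<le> C * real_of_int q powr \<eta>" unfolding S_def .
  qed
qed

text \<open>
  Vectors that are proportional to (c1, c2, c3, c4) modulo p form a lattice of index p^3. A box with more than
  p^3 points contains two congruent modulo this lattice (Dirichlet's box principle); their difference
  is a short vector. Its first entry is nonzero modulo p, for otherwise all entries would be divisible
  by p and, being smaller than p, would vanish.
\<close>

lemma simultaneous_small_multiple: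
  fixes p A1 A2 A3 A4 :: nat and c1 c2 c3 c4 :: int
  assumes p: "Factorial_Ring.prime p" and c1: "\<not> int p dvd c1"
    and small: "A1 < p" "A2 < p" "A3 < p" "A4 < p"
    and large: "p ^ 3 < (A1 + 1) * ((A2 + 1) * ((A3 + 1) * (A4 + 1)))"
  obtains v1 v2 v3 v4 :: int where "\<not> int p dvd v1"
    "\<bar>v1\<bar> \<le> int A1" "\<bar>v2\<bar> \<le> int A2" "\<bar>v3\<bar> \<le> int A3" "\<bar>v4\<bar> \<le> int A4"
    "int p dvd v2 * c1 - v1 * c2" "int p dvd v3 * c1 - v1 * c3" "int p dvd v4 * c1 - v1 * c4"
proof -
  define Box where "Box = {0..int A1} \<times> {0..int A2} \<times> {0..int A3} \<times> {0..int A4}"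
  define R where "R = {0..<int p}"
  define f where "f = (\<lambda>(w1, w2, w3, w4). ((w2 * c1 - w1 * c2) mod int p,
     (w3 * c1 - w1 * c3) mod int p, (w4 * c1 - w1 * c4) mod int p))"
  have p0: "int p > 0" using p prime_gt_0_nat by simp
  have "f ` Box \<subseteq> R \<times> R \<times> R" using p0 by (auto simp: f_def R_def)
  then have "card (f ` Box) \<le> card (R \<times> R \<times> R)" by (intro card_mono) (auto simp: R_def)
  also have "\<dots> = p ^ 3" by (simp add: R_def card_cartesian_product power3_eq_cube)
  also have "\<dots> < card Box" using large by (simp add: Box_def card_cartesian_product nat_add_distrib)
  finally have "\<not> inj_on f Box" by (rule pigeonhole)
  then obtain x y where xy: "x \<in> Box" "y \<in> Box" "f x = f y" "x \<noteq> y" unfolding inj_on_def by blast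
  obtain x1 x2 x3 x4 y1 y2 y3 y4 where [simp]: "x = (x1, x2, x3, x4)" "y = (y1, y2, y3, y4)"
    by (metis surj_pair)
  have bounds: "\<bar>x1 - y1\<bar> \<le> int A1" "\<bar>x2 - y2\<bar> \<le> int A2" "\<bar>x3 - y3\<bar> \<le> int A3" "\<bar>x4 - y4\<bar> \<le> int A4"
    using xy(1,2) by (auto simp: Box_def)
  have dv: "int p dvd (x2 - y2) * c1 - (x1 - y1) * c2" "int p dvd (x3 - y3) * c1 - (x1 - y1) * c3"
    "int p dvd (x4 - y4) * c1 - (x1 - y1) * c4"
    using xy(3) by (auto simp: f_def mod_eq_dvd_iff algebra_simps)
  have pi: "Factorial_Ring.prime (int p)" using p by simp
  have "\<not> int p dvd x1 - y1"
  proof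
    assume d1: "int p dvd x1 - y1"
    have d: "int p dvd w" if "int p dvd w * c1 - (x1 - y1) * c" for w c
    proof -
      have "int p dvd (w * c1 - (x1 - y1) * c) + (x1 - y1) * c" using that d1 by (intro dvd_add) auto
      then have "int p dvd w * c1" by simp
      then show ?thesis using c1 pi prime_dvd_mult_iff by blast
    qed
    have z: "w = 0" if "int p dvd w" "\<bar>w\<bar> \<le> int A" "A < p" for w A
      using that dvd_imp_le_int[of w "int p"] by force
    have "x1 = y1" "x2 = y2" "x3 = y3" "x4 = y4"
      using z[OF d1 bounds(1) small(1)] z[OF d[OF dv(1)] bounds(2) small(2)]
        z[OF d[OF dv(2)] bounds(3) small(3)] z[OF d[OF dv(3)] bounds(4) small(4)] by auto
    then show False using xy(4) by simp
  qed
  then show ?thesis using bounds dv by (rule that)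
qed

text \<open>
  Fix one solution (x0, y0) and write the congruence for f(x) = g f(y) in the shifts s = x - x0 and
  t = y - y0: it has no constant term and coefficients (a, -g a, c3, c4). Replace these by a short
  proportional vector v whose first two entries are at most A / H^2 and whose last two are at
  most A / H, where A = H^(3/2) p^(3/4); this choice balances the four terms and is just large enough
  for the box principle. On the box the form v1 s^2 + v2 t^2 + v3 s + v4 t is at most 4 A in absolute value
  and divisible by p, so it takes O(1 + A / p) values, and A / p = H^(3/2) p^(-1/4). Each value gives one
  conic over the integers. Its degenerate case is excluded modulo p, because the relevant
  determinant is a unit times the discriminant of f times 1 - g. The hypothesis H^2 < p is what makes
  A / H smaller than p.
\<close>

lemma quadratic_ratio_box_bound:
  fixes \<eta> :: real
  assumes \<eta>: "\<eta> > 0"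
  obtains C :: real where "C > 0"
    "\<And>(p :: nat) (H :: nat) (a :: int) b c g u.
       Factorial_Ring.prime p \<Longrightarrow> p > 2 \<Longrightarrow> \<not> int p dvd a \<Longrightarrow> \<not> int p dvd b\<^sup>2 - 4 * a * c \<Longrightarrow>
       \<not> int p dvd g \<Longrightarrow> \<not> int p dvd 1 - g \<Longrightarrow> H > 0 \<Longrightarrow> H\<^sup>2 < p \<Longrightarrow>
       real (card {(x, y) \<in> {u + 1..u + int H} \<times> {u + 1..u + int H}.
           int p dvd (a * x\<^sup>2 + b * x + c) - g * (a * y\<^sup>2 + b * y + c)})
         \<le> C * (1 + real H powr (3/2) * real p powr (-1/4)) * real p powr \<eta>"
proof -
  obtain C where C: "C > 0"
    "\<And>q v1 v2 v3 v4 k :: int. q \<ge> 3 \<Longrightarrow> v1 \<noteq> 0 \<Longrightarrow> v2 \<noteq> 0 \<Longrightarrow>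
       4 * v1 * v2 * k + v2 * v3\<^sup>2 + v1 * v4\<^sup>2 \<noteq> 0 \<Longrightarrow>
       \<bar>v1\<bar> \<le> q \<Longrightarrow> \<bar>v2\<bar> \<le> q \<Longrightarrow> \<bar>v3\<bar> \<le> q \<Longrightarrow> \<bar>v4\<bar> \<le> q \<Longrightarrow>
       real (card {(s, t). \<bar>s\<bar> \<le> q \<and> \<bar>t\<bar> \<le> q \<and> v1 * s\<^sup>2 + v2 * t\<^sup>2 + v3 * s + v4 * t = k})
         \<le> C * real_of_int q powr \<eta>"
    using conic_box_bound[OF \<eta>] by blast
  show ?thesis
  proof
    show "8 * C > 0" using C(1) by simp
    fix p H :: nat and a b c g u :: int
    assume p: "Factorial_Ring.prime p" "p > 2" and pa: "\<not> int p dvd a"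
      and disc: "\<not> int p dvd b\<^sup>2 - 4 * a * c" and g: "\<not> int p dvd g" "\<not> int p dvd 1 - g"
      and H: "H > 0" "H\<^sup>2 < p"
    define S where "S = {(x, y) \<in> {u + 1..u + int H} \<times> {u + 1..u + int H}.
           int p dvd (a * x\<^sup>2 + b * x + c) - g * (a * y\<^sup>2 + b * y + c)}"
    have pi: "Factorial_Ring.prime (int p)" using p by simp
    have finS: "finite S"
      by (rule finite_subset[of _ "{u + 1..u + int H} \<times> {u + 1..u + int H}"]) (auto simp: S_def)
    define h P where "h = real H" and "P = real p"
    have h1: "h \<ge> 1" using H by (simp add: h_def)
    have P3: "P \<ge> 3" using p by (simp add: P_def)
    have hP2: "h\<^sup>2 < P" using H(2) unfolding h_def P_def by (metis of_nat_less_iff of_nat_power)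
    have hP: "h powr (1/2) < P powr (1/4)"
    proof -
      have "h powr 2 < P" using hP2 h1 by (simp add: powr_numeral)
      then have "(h powr 2) powr (1/4) < P powr (1/4)" by (intro powr_less_mono2) auto
      then show ?thesis by (simp add: powr_powr)
    qed
    \<comment> \<open>r1 = A / H^2 and r3 = A / H; their product is p^(3/2), so (A1 + 1)^2 (A3 + 1)^2 exceeds p^3.\<close>
    define r1 r3 where "r1 = h powr (-1/2) * P powr (3/4)" and "r3 = h powr (1/2) * P powr (3/4)"
    define A1 A3 where "A1 = nat \<lfloor>r1\<rfloor>" and "A3 = nat \<lfloor>r3\<rfloor>"
    have r0: "r1 \<ge> 0" "r3 \<ge> 0" by (simp_all add: r1_def r3_def)
    have A: "real A1 \<le> r1" "real A3 \<le> r3" "r1 < real A1 + 1" "r3 < real A3 + 1"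
      using r0 by (simp_all add: A1_def A3_def)
    have "r3 < P powr (1/4) * P powr (3/4)" unfolding r3_def using hP P3 by (intro mult_strict_right_mono) auto
    also have "\<dots> = P" using P3 by (simp add: powr_add[symmetric])
    finally have r3P: "r3 < P" .
    have "r1 \<le> r3" unfolding r1_def r3_def using h1 by (intro mult_right_mono powr_mono) auto
    then have small: "A1 < p" "A3 < p" using A r3P unfolding P_def by linarith+
    have "r1 * r3 = (h powr (-1/2) * h powr (1/2)) * (P powr (3/4) * P powr (3/4))"
      by (simp add: r1_def r3_def)
    also have "\<dots> = P powr (3/2)" using h1 by (simp add: powr_add[symmetric])
    finally have rr: "r1 * r3 = P powr (3/2)" .
    have "P ^ 3 = P powr (3/2) * P powr (3/2)" using P3 by (simp add: powr_add[symmetric] powr_numeral)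
    also have "\<dots> = (r1 * r3) * (r1 * r3)" unfolding rr ..
    also have "\<dots> < ((real A1 + 1) * (real A3 + 1)) * ((real A1 + 1) * (real A3 + 1))"
      using A r0 by (intro mult_strict_mono) (auto intro!: mult_strict_mono mult_nonneg_nonneg)
    also have "\<dots> = real ((A1 + 1) * ((A1 + 1) * ((A3 + 1) * (A3 + 1))))" by (simp add: algebra_simps)
    finally have large: "p ^ 3 < (A1 + 1) * ((A1 + 1) * ((A3 + 1) * (A3 + 1)))"
      unfolding P_def by (metis of_nat_less_iff of_nat_power)
    have r1h: "r1 * h\<^sup>2 = h powr (3/2) * P powr (3/4)"
      using h1 by (simp add: r1_def powr_add[symmetric] powr_numeral[symmetric] mult_ac del: powr_numeral)
    have r3h: "r3 * h = h powr (3/2) * P powr (3/4)"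
    proof -
      have "r3 * h = (h powr (1/2) * h powr 1) * P powr (3/4)" using h1 by (simp add: r3_def mult_ac)
      then show ?thesis unfolding powr_add[symmetric] by simp
    qed
    show "real (card {(x, y) \<in> {u + 1..u + int H} \<times> {u + 1..u + int H}.
           int p dvd (a * x\<^sup>2 + b * x + c) - g * (a * y\<^sup>2 + b * y + c)})
         \<le> 8 * C * (1 + real H powr (3/2) * real p powr (-1/4)) * real p powr \<eta>"
    proof (cases "S = {}")
      case True
      then show ?thesis unfolding S_def[symmetric] using C(1) by simp
    next
      case False
      then obtain x0 y0 where xy0: "(x0, y0) \<in> S" by (metis ex_in_conv surj_pair)
      define F where "F x = a * x\<^sup>2 + b * x + c" for x
      have base: "int p dvd F x0 - g * F y0" using xy0 by (simp add: S_def F_def)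
      define c3 c4 where "c3 = 2 * a * x0 + b" and "c4 = - (g * (2 * a * y0 + b))"
      obtain v1 v2 v3 v4 where v: "\<not> int p dvd v1"
        "\<bar>v1\<bar> \<le> int A1" "\<bar>v2\<bar> \<le> int A1" "\<bar>v3\<bar> \<le> int A3" "\<bar>v4\<bar> \<le> int A3"
        "int p dvd v2 * a - v1 * (- (g * a))" "int p dvd v3 * a - v1 * c3" "int p dvd v4 * a - v1 * c4"
        using simultaneous_small_multiple[OF p(1) pa small(1,1,2,2) large] by blast
      have v2: "\<not> int p dvd v2"
      proof
        assume "int p dvd v2"
        then have "int p dvd v2 * a - (v2 * a - v1 * (- (g * a)))" by (rule dvd_diff[OF dvd_mult2 v(6)])
        then have "int p dvd v1 * g * a" by (simp add: mult.assoc)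
        then show False using pi pa v(1) g(1) by (auto simp: prime_dvd_mult_iff)
      qed
      define Q where "Q s t = v1 * s\<^sup>2 + v2 * t\<^sup>2 + v3 * s + v4 * t" for s t
      have Qdvd: "int p dvd Q (x - x0) (y - y0)" if "(x, y) \<in> S" for x y
      proof -
        define s t where "s = x - x0" and "t = y - y0"
        have "int p dvd F x - g * F y" using that by (simp add: S_def F_def)
        from dvd_diff[OF this base] have "int p dvd v1 * ((F x - g * F y) - (F x0 - g * F y0))"
          by (rule dvd_mult)
        moreover have "(F x - g * F y) - (F x0 - g * F y0) = a * s\<^sup>2 + (- (g * a)) * t\<^sup>2 + c3 * s + c4 * t"
          by (simp add: F_def c3_def c4_def s_def t_def power2_eq_square algebra_simps)
        ultimately have 1: "int p dvd v1 * (a * s\<^sup>2 + (- (g * a)) * t\<^sup>2 + c3 * s + c4 * t)" by simp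
        have 2: "int p dvd (v2 * a - v1 * (- (g * a))) * t\<^sup>2 + (v3 * a - v1 * c3) * s + (v4 * a - v1 * c4) * t"
          using v(6-8) by (intro dvd_add dvd_mult2)
        have "a * Q s t = v1 * (a * s\<^sup>2 + (- (g * a)) * t\<^sup>2 + c3 * s + c4 * t)
            + ((v2 * a - v1 * (- (g * a))) * t\<^sup>2 + (v3 * a - v1 * c3) * s + (v4 * a - v1 * c4) * t)"
          by (simp add: Q_def algebra_simps)
        also have "int p dvd \<dots>" using 1 2 by (rule dvd_add)
        finally have "int p dvd a * Q s t" .
        then show ?thesis using pa pi by (simp add: prime_dvd_mult_iff s_def t_def)
      qed
      \<comment> \<open>Modulo p the term with k = p i disappears; a^3 times the rest is a unit times the discriminant times 1 - g.\<close>
      have nondeg: "4 * v1 * v2 * (int p * i) + v2 * v3\<^sup>2 + v1 * v4\<^sup>2 \<noteq> 0" for i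
      proof
        assume "4 * v1 * v2 * (int p * i) + v2 * v3\<^sup>2 + v1 * v4\<^sup>2 = 0"
        then have "v2 * v3\<^sup>2 + v1 * v4\<^sup>2 = int p * (- (4 * v1 * v2 * i))" by (simp add: algebra_simps)
        then have d0: "int p dvd a ^ 3 * (v2 * v3\<^sup>2 + v1 * v4\<^sup>2)" by simp
        have m: "[v2 * a = v1 * (- (g * a))] (mod int p)" "[v3 * a = v1 * c3] (mod int p)"
          "[v4 * a = v1 * c4] (mod int p)" using v(6-8) by (simp_all add: cong_iff_dvd_diff)
        have "[(v2 * a) * (v3 * a)\<^sup>2 + (v1 * a) * (v4 * a)\<^sup>2
            = (v1 * (- (g * a))) * (v1 * c3)\<^sup>2 + (v1 * a) * (v1 * c4)\<^sup>2] (mod int p)"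
          
          by (rule cong_add[OF cong_mult[OF m(1) cong_pow[OF m(2)]]
                cong_mult[OF cong_refl cong_pow[OF m(3)]]])
        moreover have "(v2 * a) * (v3 * a)\<^sup>2 + (v1 * a) * (v4 * a)\<^sup>2 = a ^ 3 * (v2 * v3\<^sup>2 + v1 * v4\<^sup>2)"
          by (simp add: power2_eq_square power3_eq_cube algebra_simps)
        ultimately have "int p dvd (v1 * (- (g * a))) * (v1 * c3)\<^sup>2 + (v1 * a) * (v1 * c4)\<^sup>2"
          using d0 by (metis cong_dvd_iff)
        also have "(v1 * (- (g * a))) * (v1 * c3)\<^sup>2 + (v1 * a) * (v1 * c4)\<^sup>2
            = - (v1 ^ 3 * g * a * ((b\<^sup>2 - 4 * a * c) * (1 - g) + 4 * a * (F x0 - g * F y0)))"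
          by (simp add: c3_def c4_def F_def power2_eq_square power3_eq_cube algebra_simps)
        finally have "int p dvd v1 ^ 3 * g * a * ((b\<^sup>2 - 4 * a * c) * (1 - g) + 4 * a * (F x0 - g * F y0))"
          by simp
        moreover have "\<not> int p dvd v1 ^ 3" using pi v(1) prime_dvd_power by blast
        ultimately have "int p dvd (b\<^sup>2 - 4 * a * c) * (1 - g) + 4 * a * (F x0 - g * F y0)"
          using pi pa g(1) by (auto simp: prime_dvd_mult_iff)
        moreover have "int p dvd 4 * a * (F x0 - g * F y0)" using base by simp
        ultimately have "int p dvd (b\<^sup>2 - 4 * a * c) * (1 - g)" by (simp only: dvd_add_left_iff)
        then show False using pi disc g(2) by (simp add: prime_dvd_mult_iff)
      qed
      define R where "R = h powr (3/2) * P powr (-1/4)"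
      have R0: "R \<ge> 0" by (simp add: R_def)
      \<comment> \<open>The form divided by p takes only integer values between -m and m.\<close>
      define m where "m = \<lfloor>4 * R\<rfloor>"
      define \<kappa> where "\<kappa> = (\<lambda>(x, y). Q (x - x0) (y - y0) div int p)"
      have near: "\<bar>x - x0\<bar> \<le> int H" "\<bar>y - y0\<bar> \<le> int H" if "(x, y) \<in> S" for x y
        using that xy0 by (auto simp: S_def)
      have "\<kappa> ` S \<subseteq> {-m..m}"
      proof
        fix i assume "i \<in> \<kappa> ` S"
        then obtain x y where xy: "(x, y) \<in> S" "i = Q (x - x0) (y - y0) div int p" by (auto simp: \<kappa>_def)
        define s t where "s = x - x0" and "t = y - y0"
        have Qi: "Q s t = int p * i" using Qdvd[OF xy(1)] xy(2) by (simp add: s_def t_def)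
        have st: "\<bar>real_of_int s\<bar> \<le> h" "\<bar>real_of_int t\<bar> \<le> h"
          using near[OF xy(1)] unfolding s_def t_def h_def by linarith+
        have vr: "\<bar>real_of_int v1\<bar> \<le> r1" "\<bar>real_of_int v2\<bar> \<le> r1" "\<bar>real_of_int v3\<bar> \<le> r3" "\<bar>real_of_int v4\<bar> \<le> r3"
          using v(2-5) A(1,2) by linarith+
        have sq: "\<bar>w * z\<^sup>2\<bar> \<le> r1 * h\<^sup>2" if "\<bar>w\<bar> \<le> r1" "\<bar>z\<bar> \<le> h" for w z :: real
        proof -
          have "\<bar>z\<bar>\<^sup>2 \<le> h\<^sup>2" using that by (intro power_mono) auto
          then show ?thesis unfolding abs_mult using that r0 by (intro mult_mono) auto
        qed
        have ln: "\<bar>w * z\<bar> \<le> r3 * h" if "\<bar>w\<bar> \<le> r3" "\<bar>z\<bar> \<le> h" for w z :: real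
          unfolding abs_mult using that r0 by (intro mult_mono) auto
        have "real_of_int (Q s t) = real_of_int v1 * (real_of_int s)\<^sup>2 + real_of_int v2 * (real_of_int t)\<^sup>2
            + real_of_int v3 * real_of_int s + real_of_int v4 * real_of_int t" by (simp add: Q_def)
        then have "\<bar>real_of_int (Q s t)\<bar> \<le> 4 * (h powr (3/2) * P powr (3/4))"
          using sq[OF vr(1) st(1)] sq[OF vr(2) st(2)] ln[OF vr(3) st(1)] ln[OF vr(4) st(2)]
          unfolding r1h r3h by linarith
        also have "h powr (3/2) * P powr (3/4) = P * R"
        proof -
          have "P powr (3/4) = P powr 1 * P powr (-1/4)" unfolding powr_add[symmetric] by simp
          then show ?thesis using P3 by (simp add: R_def mult_ac)
        qed
        finally have "P * \<bar>real_of_int i\<bar> \<le> P * (4 * R)" unfolding Qi by (simp add: abs_mult P_def)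
        then have "\<bar>real_of_int i\<bar> \<le> 4 * R" using P3 by simp
        then show "i \<in> {-m..m}" unfolding m_def by (simp add: le_floor_iff) linarith
      qed
      moreover have "real (card {z \<in> S. \<kappa> z = i}) \<le> C * P powr \<eta>" for i
      proof -
        define E where "E = {(s, t). \<bar>s\<bar> \<le> int p \<and> \<bar>t\<bar> \<le> int p \<and> v1 * s\<^sup>2 + v2 * t\<^sup>2 + v3 * s + v4 * t = int p * i}"
        have "H \<le> H\<^sup>2" by (simp add: power2_eq_square)
        then have Hp: "H < p" using H by linarith
        have "(\<lambda>(x, y). (x - x0, y - y0)) ` {z \<in> S. \<kappa> z = i} \<subseteq> E"
        proof
          fix w assume "w \<in> (\<lambda>(x, y). (x - x0, y - y0)) ` {z \<in> S. \<kappa> z = i}"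
          then obtain x y where xy: "(x, y) \<in> S" "i = Q (x - x0) (y - y0) div int p" "w = (x - x0, y - y0)"
            by (auto simp: \<kappa>_def)
          then have "Q (x - x0) (y - y0) = int p * i" using Qdvd[OF xy(1)] by simp
          then show "w \<in> E" using near[OF xy(1)] Hp by (simp add: E_def xy(3) Q_def)
        qed
        moreover have "inj_on (\<lambda>(x, y). (x - x0, y - y0)) {z \<in> S. \<kappa> z = i}" by (auto simp: inj_on_def)
        moreover have "finite E"
          by (rule finite_subset[of _ "{-int p..int p} \<times> {-int p..int p}"]) (auto simp: E_def)
        ultimately have "card {z \<in> S. \<kappa> z = i} \<le> card E" by (intro card_inj_on_le)
        moreover have "real (card E) \<le> C * real_of_int (int p) powr \<eta>"
          unfolding E_def using p(2) v(1-5) v2 small nondeg[of i] by (intro C(2)) auto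
        ultimately show ?thesis by (simp add: P_def)
      qed
      ultimately have "real (card S) \<le> real (card {-m..m}) * (C * P powr \<eta>)"
        using finS by (intro card_le_fibres[where f = \<kappa>]) auto
      also have "real (card {-m..m}) \<le> 8 * (1 + R)"
      proof -
        have "real_of_int m \<le> 4 * R" "m \<ge> 0" using R0 by (auto simp: m_def)
        then show ?thesis by simp
      qed
      then have "real (card {-m..m}) * (C * P powr \<eta>) \<le> 8 * (1 + R) * (C * P powr \<eta>)"
        using C(1) by (intro mult_right_mono) auto
      also have "\<dots> = 8 * C * (1 + R) * P powr \<eta>" by simp
      finally show ?thesis unfolding S_def R_def h_def P_def .
    qed
  qed
qed

section \<open>Values in a multiplicative group\<close>

text \<open>
  Count pairs of values by their ratio, which lies in G. Choosing one preimage for each value keeps the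
  ratio 1 harmless: it arises only from the diagonal and costs card V, whereas counting all
  points of I would also admit the pairs x \<noteq> y with F x = F y. Every other ratio g costs at most M.
\<close>

lemma card_values_squared_le:
  fixes p :: nat and I G :: "int set" and F :: "int \<Rightarrow> int" and M :: real
  assumes G: "G \<subseteq> {1..<int p}" and I: "finite I" and M: "M \<ge> 0"
    and ratio: "\<And>v w. v \<in> G \<Longrightarrow> w \<in> G \<Longrightarrow> \<exists>g\<in>G. [v = g * w] (mod int p)"
    and fibre: "\<And>g. \<not> int p dvd g \<Longrightarrow> \<not> int p dvd 1 - g \<Longrightarrow>
      real (card {(x, y) \<in> I \<times> I. int p dvd F x - g * F y}) \<le> M"
  defines "V \<equiv> (\<lambda>x. F x mod int p) ` I \<inter> G"
  shows "(real (card V))\<^sup>2 \<le> real (card V) + real (card G) * M"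
proof -
  have finV: "finite V" using I by (simp add: V_def)
  have finG: "finite G" using G finite_subset by blast
  define rep where "rep v = (SOME x. x \<in> I \<and> F x mod int p = v)" for v
  have rep: "rep v \<in> I" "F (rep v) mod int p = v" if "v \<in> V" for v
  proof -
    have "\<exists>x. x \<in> I \<and> F x mod int p = v" using that by (auto simp: V_def)
    then have "rep v \<in> I \<and> F (rep v) mod int p = v" unfolding rep_def by (rule someI_ex)
    then show "rep v \<in> I" "F (rep v) mod int p = v" by auto
  qed
  define S where "S = {(v, w) \<in> V \<times> V. v \<noteq> w}"
  define r where "r z = (SOME g. g \<in> G \<and> [fst z = g * snd z] (mod int p))" for z
  have r: "r z \<in> G" "[fst z = r z * snd z] (mod int p)" if "z \<in> S" for z
  proof -
    have "fst z \<in> G" "snd z \<in> G" using that by (auto simp: S_def V_def)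
    then have "\<exists>g. g \<in> G \<and> [fst z = g * snd z] (mod int p)" using ratio by blast
    then have "r z \<in> G \<and> [fst z = r z * snd z] (mod int p)" unfolding r_def by (rule someI_ex)
    then show "r z \<in> G" "[fst z = r z * snd z] (mod int p)" by auto
  qed
  have finS: "finite S" by (rule finite_subset[of _ "V \<times> V"]) (use finV in \<open>auto simp: S_def\<close>)
  have fib: "real (card {z \<in> S. r z = g}) \<le> M" if gG: "g \<in> G" for g
  proof (cases "{z \<in> S. r z = g} = {}")
    case True
    show ?thesis unfolding True using M by simp
  next
    case False
    then obtain v w where vw: "(v, w) \<in> S" "r (v, w) = g" by auto
    have small: "v \<in> {1..<int p}" "w \<in> {1..<int p}" "v \<noteq> w" using vw G by (auto simp: S_def V_def)
    have g1: "\<not> int p dvd 1 - g"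
    proof
      assume "int p dvd 1 - g"
      then have "int p dvd (1 - g) * w" by simp
      then have "[w = g * w] (mod int p)" by (simp add: cong_iff_dvd_diff algebra_simps)
      then have "[v = w] (mod int p)" using r(2)[OF vw(1)] vw(2) by (auto intro: cong_trans cong_sym)
      then show False using small by (auto simp: cong_def)
    qed
    have g0: "\<not> int p dvd g" using gG G zdvd_not_zless by fastforce
    define E where "E = {(x, y) \<in> I \<times> I. int p dvd F x - g * F y}"
    have finE: "finite E" by (rule finite_subset[of _ "I \<times> I"]) (use I in \<open>auto simp: E_def\<close>)
    have "(\<lambda>(v, w). (rep v, rep w)) ` {z \<in> S. r z = g} \<subseteq> E"
    proof
      fix q assume "q \<in> (\<lambda>(v, w). (rep v, rep w)) ` {z \<in> S. r z = g}"
      then obtain v w where q: "(v, w) \<in> S" "r (v, w) = g" "q = (rep v, rep w)" by auto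
      have V: "v \<in> V" "w \<in> V" using q by (auto simp: S_def)
      have "[F (rep v) = v] (mod int p)" "[F (rep w) = w] (mod int p)"
        using rep(2)[OF V(1)] rep(2)[OF V(2)] by (metis cong_def mod_mod_trivial)+
      moreover have "[v = g * w] (mod int p)" using r(2)[OF q(1)] q(2) by simp
      ultimately have "[F (rep v) = g * F (rep w)] (mod int p)"
        by (meson cong_scalar_left cong_sym cong_trans)
      then show "q \<in> E" using rep(1) V q(3) by (simp add: E_def cong_iff_dvd_diff)
    qed
    moreover have "inj_on (\<lambda>(v, w). (rep v, rep w)) {z \<in> S. r z = g}"
    proof (rule inj_onI)
      fix q q' assume q: "q \<in> {z \<in> S. r z = g}" "q' \<in> {z \<in> S. r z = g}"
        "(case q of (v, w) \<Rightarrow> (rep v, rep w)) = (case q' of (v, w) \<Rightarrow> (rep v, rep w))"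
      have "fst q \<in> V" "snd q \<in> V" "fst q' \<in> V" "snd q' \<in> V" using q(1,2) by (auto simp: S_def)
      moreover have "rep (fst q) = rep (fst q')" "rep (snd q) = rep (snd q')"
        using q(3) by (simp_all add: case_prod_beta)
      ultimately have "fst q = fst q'" "snd q = snd q'" using rep(2) by metis+
      then show "q = q'" by (rule prod_eqI)
    qed
    ultimately have "card {z \<in> S. r z = g} \<le> card E" using finE by (intro card_inj_on_le)
    then show ?thesis using fibre[OF g0 g1] unfolding E_def by linarith
  qed
  have "real (card S) \<le> real (card G) * M"
    by (rule card_le_fibres[where f = r]) (use finG finS r(1) fib in auto)
  moreover have "V \<times> V \<subseteq> (\<lambda>v. (v, v)) ` V \<union> S" by (auto simp: S_def)
  then have "card (V \<times> V) \<le> card ((\<lambda>v. (v, v)) ` V \<union> S)" using finV finS by (intro card_mono) auto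
  then have "card (V \<times> V) \<le> card V + card S"
    using card_Un_le[of "(\<lambda>v. (v, v)) ` V" S] card_image_le[OF finV, of "\<lambda>v. (v, v)"] by linarith
  then have "real (card V * card V) \<le> real (card V + card S)"
    unfolding card_cartesian_product by (simp only: of_nat_le_iff)
  ultimately show ?thesis by (simp add: power2_eq_square)
qed

text \<open>
  Put N for the number of values and T for the order of G. If H^2 \<ge> p, the trivial bound
  N^2 \<le> H T suffices, since H^(1/2) \<le> H^(3/4) p^(-1/8). If H^2 < p, pair counting gives
  N^2 \<le> N + T M with M = C (1 + H^(3/2) p^(-1/4)) p^\<eta>, and N \<le> T. In this range p exceeds H, so
  constants, too, are at most p^\<eta> for large H. This is why an exponent depending on H alone can be uniform in p.
\<close>

lemma quadratic_values_in_group_bound: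
  fixes \<eta> :: real
  assumes \<eta>: "\<eta> > 0"
  obtains H0 :: nat where
    "\<And>(p :: nat) (H :: nat) (a :: int) b c u G.
       H \<ge> H0 \<Longrightarrow> Factorial_Ring.prime p \<Longrightarrow> \<not> int p dvd a \<Longrightarrow> (p > 2 \<Longrightarrow> \<not> int p dvd b\<^sup>2 - 4 * a * c) \<Longrightarrow>
       G \<subseteq> {1..<int p} \<Longrightarrow>
       (\<And>v w. v \<in> G \<Longrightarrow> w \<in> G \<Longrightarrow> \<exists>g\<in>G. [v = g * w] (mod int p)) \<Longrightarrow>
       real (card ((\<lambda>x. (a * x\<^sup>2 + b * x + c) mod int p) ` {u + 1..u + int H} \<inter> G))
         \<le> (1 + real H powr (3/4) * real p powr (-1/8)) * real (card G) powr (1/2) * real p powr \<eta>"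
proof -
  obtain C where C: "C > 0"
    "\<And>(p :: nat) (H :: nat) (a :: int) b c g u.
       Factorial_Ring.prime p \<Longrightarrow> p > 2 \<Longrightarrow> \<not> int p dvd a \<Longrightarrow> \<not> int p dvd b\<^sup>2 - 4 * a * c \<Longrightarrow>
       \<not> int p dvd g \<Longrightarrow> \<not> int p dvd 1 - g \<Longrightarrow> H > 0 \<Longrightarrow> H\<^sup>2 < p \<Longrightarrow>
       real (card {(x, y) \<in> {u + 1..u + int H} \<times> {u + 1..u + int H}.
           int p dvd (a * x\<^sup>2 + b * x + c) - g * (a * y\<^sup>2 + b * y + c)})
         \<le> C * (1 + real H powr (3/2) * real p powr (-1/4)) * real p powr \<eta>"
    using quadratic_ratio_box_bound[OF \<eta>] by blast
  \<comment> \<open>Then 1 + C \<le> p^\<eta> as soon as p > H \<ge> H0, and H > 2 excludes p = 2 in the range H^2 < p.\<close>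
  obtain H0 :: nat where H0: "(1 + C) powr (1 / \<eta>) + 2 < real H0" using reals_Archimedean2 by blast
  show ?thesis
  proof
    fix p H :: nat and a b c u :: int and G :: "int set"
    assume HH: "H \<ge> H0" and p: "Factorial_Ring.prime p" and pa: "\<not> int p dvd a"
      and disc: "p > 2 \<Longrightarrow> \<not> int p dvd b\<^sup>2 - 4 * a * c"
      and G: "G \<subseteq> {1..<int p}"
      and ratio: "\<And>v w. v \<in> G \<Longrightarrow> w \<in> G \<Longrightarrow> \<exists>g\<in>G. [v = g * w] (mod int p)"
    define F where "F x = a * x\<^sup>2 + b * x + c" for x
    define I where "I = {u + 1..u + int H}"
    define V where "V = (\<lambda>x. F x mod int p) ` I \<inter> G"
    define N T P h where "N = real (card V)" and "T = real (card G)" and "P = real p" and "h = real H"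
    define w where "w = h powr (3/4) * P powr (-1/8)"
    have finG: "finite G" using G finite_subset by blast
    have p2: "p \<ge> 2" using p by (rule prime_ge_2_nat)
    have P2: "P \<ge> 2" using p2 by (simp add: P_def)
    have H2: "H > 2" using HH H0 powr_ge_zero[of "1 + C" "1 / \<eta>"] by linarith
    have h2: "h > 2" using H2 by (simp add: h_def)
    have Pe: "P powr \<eta> \<ge> 1" using P2 \<eta> by (simp add: ge_one_powr_ge_zero)
    have w0: "w \<ge> 0" by (simp add: w_def)
    have T0: "T \<ge> 0" "N \<ge> 0" by (simp_all add: T_def N_def)
    have NT: "N \<le> T" unfolding N_def T_def V_def using finG by (simp add: card_mono)
    have Nh: "N \<le> h"
    proof -
      have "card V \<le> card ((\<lambda>x. F x mod int p) ` I)" unfolding V_def I_def by (intro card_mono) auto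
      also have "\<dots> \<le> card I" by (rule card_image_le) (simp add: I_def)
      finally show ?thesis by (simp add: N_def h_def I_def)
    qed
    have T_sqrt: "(T powr (1/2))\<^sup>2 = T" using T0 by (simp add: powr_half_sqrt)
    have "N \<le> (1 + w) * T powr (1/2) * P powr \<eta>"
    proof (cases "H\<^sup>2 < p")
      case False
      have "N\<^sup>2 \<le> h * T" unfolding power2_eq_square using Nh NT T0 by (intro mult_mono) auto
      also have "\<dots> = (h powr (1/2) * T powr (1/2))\<^sup>2"
        using T_sqrt h2 by (simp add: power_mult_distrib powr_half_sqrt)
      finally have N1: "N \<le> h powr (1/2) * T powr (1/2)" by (rule power2_le_imp_le) simp
      have "P \<le> h powr 2"
      proof -
        have "real p \<le> real (H\<^sup>2)" using False by simp
        then show ?thesis using h2 by (simp add: P_def h_def powr_numeral)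
      qed
      then have "P powr (1/8) \<le> (h powr 2) powr (1/8)" using P2 by (intro powr_mono2) auto
      also have "\<dots> = h powr (1/4)" by (simp add: powr_powr)
      finally have "P powr (1/8) * h powr (1/2) \<le> h powr (1/4) * h powr (1/2)"
        by (intro mult_right_mono) auto
      also have "\<dots> = h powr (3/4)" by (simp add: powr_add[symmetric])
      finally have "h powr (1/2) \<le> w"
        using P2 by (simp add: w_def powr_minus field_simps)
      then have "h powr (1/2) * T powr (1/2) * 1 \<le> (1 + w) * T powr (1/2) * P powr \<eta>"
        using Pe w0 by (intro mult_mono) auto
      then show ?thesis using N1 by simp
    next
      case True
      have "3 * 1 \<le> H * H" using H2 by (intro mult_le_mono) auto
      then have "2 < H\<^sup>2" by (simp add: power2_eq_square)
      then have p3: "p > 2" using True by linarith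
      have w2: "h powr (3/2) * P powr (-1/4) = w\<^sup>2"
      proof -
        have "w\<^sup>2 = (h powr (3/4) * h powr (3/4)) * (P powr (-1/8) * P powr (-1/8))"
          by (simp add: w_def power2_eq_square mult_ac)
        then show ?thesis unfolding powr_add[symmetric] by simp
      qed
      define M where "M = C * (1 + w\<^sup>2) * P powr \<eta>"
      have M0: "M \<ge> 0" using C(1) by (simp add: M_def)
      have "N\<^sup>2 \<le> N + T * M" unfolding N_def T_def V_def
      proof (rule card_values_squared_le[OF G _ M0 ratio])
        fix g assume g: "\<not> int p dvd g" "\<not> int p dvd 1 - g"
        show "real (card {(x, y) \<in> I \<times> I. int p dvd F x - g * F y}) \<le> M"
          unfolding I_def F_def M_def w2[symmetric] h_def P_def
          using H2 by (intro C(2) p p3 pa disc g True) auto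
      qed (simp add: I_def)
      also have "\<dots> \<le> T * P powr \<eta> + T * M"
        using NT mult_left_mono[OF Pe T0(1)] by simp
      also have "\<dots> = T * P powr \<eta> * (1 + C * (1 + w\<^sup>2))" by (simp add: M_def algebra_simps)
      also have "\<dots> \<le> T * P powr \<eta> * ((1 + C) * (1 + w)\<^sup>2)"
      proof (intro mult_left_mono)
        have "(1 + C) * (1 + w)\<^sup>2 - (1 + C * (1 + w\<^sup>2)) = 2 * w + w\<^sup>2 + 2 * C * w"
          by (simp add: power2_eq_square algebra_simps)
        also have "\<dots> \<ge> 0" using w0 C(1) by simp
        finally show "1 + C * (1 + w\<^sup>2) \<le> (1 + C) * (1 + w)\<^sup>2" by simp
      qed (use T0 in simp)
      also have "\<dots> \<le> T * P powr \<eta> * (P powr \<eta> * (1 + w)\<^sup>2)"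
      proof (intro mult_left_mono mult_right_mono)
        have "real H \<le> real (H\<^sup>2)" by (simp only: of_nat_le_iff) (simp add: power2_eq_square)
        then have "(1 + C) powr (1 / \<eta>) \<le> P" using HH H0 True unfolding P_def by linarith
        then have "((1 + C) powr (1 / \<eta>)) powr \<eta> \<le> P powr \<eta>" using \<eta> by (intro powr_mono2) auto
        then show "1 + C \<le> P powr \<eta>" using \<eta> C(1) by (simp add: powr_powr)
      qed (use T0 in simp_all)
      also have "\<dots> = ((1 + w) * T powr (1/2) * P powr \<eta>)\<^sup>2"
        using T_sqrt by (simp add: power_mult_distrib power2_eq_square mult_ac)
      finally show ?thesis by (rule power2_le_imp_le) (use w0 in simp)
    qed
    then show "real (card ((\<lambda>x. (a * x\<^sup>2 + b * x + c) mod int p) ` {u + 1..u + int H} \<inter> G))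
         \<le> (1 + real H powr (3/4) * real p powr (-1/8)) * real (card G) powr (1/2) * real p powr \<eta>"
      unfolding N_def T_def P_def h_def w_def V_def I_def F_def .
  qed
qed

section \<open>Quadratic polynomials over a prime field\<close>

lemma (in field) poly_mult_monic_linear_square:
  assumes "s \<in> carrier R"
  shows "poly_mult [\<one>, s] [\<one>, s] = [\<one>, s \<oplus> s, s \<otimes> s]"
  using assms by simp

lemma (in field) poly_mult_quadratic_const:
  assumes "b \<in> carrier R" "c \<in> carrier R" "a \<in> carrier R" "a \<noteq> \<zero>"
  shows "poly_mult [\<one>, b, c] [a] = [a, b \<otimes> a, c \<otimes> a]"
  using assms by simp

text \<open>
  Such a polynomial is a times the square of the monic linear polynomial with constant term s, which is
  not a unit.
\<close>

lemma (in field) squarefree_quadratic_not_square: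
  assumes a: "a \<in> carrier R" "a \<noteq> \<zero>" and s: "s \<in> carrier R"
  shows "\<not> squarefree_in (univ_poly R (carrier R)) [a, (s \<oplus> s) \<otimes> a, (s \<otimes> s) \<otimes> a]"
proof
  let ?P = "univ_poly R (carrier R)"
  assume sf: "squarefree_in ?P [a, (s \<oplus> s) \<otimes> a, (s \<otimes> s) \<otimes> a]"
  have l: "[\<one>, s] \<in> carrier ?P" and c: "[a] \<in> carrier ?P"
    using a s by (auto simp: univ_poly_carrier[symmetric] polynomial_def)
  have "[a, (s \<oplus> s) \<otimes> a, (s \<otimes> s) \<otimes> a] = ([\<one>, s] \<otimes>\<^bsub>?P\<^esub> [\<one>, s]) \<otimes>\<^bsub>?P\<^esub> [a]"
    using poly_mult_monic_linear_square[OF s] poly_mult_quadratic_const[of "s \<oplus> s" "s \<otimes> s" a] a s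
    by (simp add: univ_poly_mult del: poly_mult.simps)
  then have "([\<one>, s] \<otimes>\<^bsub>?P\<^esub> [\<one>, s]) divides\<^bsub>?P\<^esub> [a, (s \<oplus> s) \<otimes> a, (s \<otimes> s) \<otimes> a]"
    using c unfolding factor_def by blast
  then have "[\<one>, s] \<in> Units ?P" using sf l unfolding squarefree_in_def by blast
  then show False using univ_poly_carrier_units_incl by auto
qed

text \<open>
  The passage from polynomials as coefficient lists to integer arithmetic. For odd p, a vanishing
  discriminant would make the polynomial a times the square of a linear one, with s = b / (2 a).
\<close>

lemma quadratic_over_residue_ring:
  fixes p :: nat and f :: "int list"
  assumes p: "Factorial_Ring.prime p"
    and f: "f \<in> carrier (univ_poly (residue_ring (int p)) (carrier (residue_ring (int p))))"
    and deg: "Polynomials.degree f = 2"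
    and sf: "squarefree_in (univ_poly (residue_ring (int p)) (carrier (residue_ring (int p)))) f"
  obtains a b c :: int where "\<not> int p dvd a" "p > 2 \<Longrightarrow> \<not> int p dvd b\<^sup>2 - 4 * a * c"
    "\<And>x. ring.eval (residue_ring (int p)) f (x mod int p) = (a * x\<^sup>2 + b * x + c) mod int p"
proof -
  define R where "R = residue_ring (int p)"
  have p1: "int p > 1" using p prime_gt_1_nat by auto
  interpret residues_prime p R by unfold_locales (use p in \<open>auto simp: R_def\<close>)
  obtain a b c where f_eq: "f = [a, b, c]"
  proof -
    have "length f = 3" using deg by simp
    then show ?thesis using that by (auto simp: numeral_3_eq_3 length_Suc_conv)
  qed
  have carr: "a \<in> carrier R" "b \<in> carrier R" "c \<in> carrier R" "a \<noteq> \<zero>\<^bsub>R\<^esub>"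
    using f unfolding f_eq R_def[symmetric] by (auto simp: univ_poly_carrier[symmetric] polynomial_def)
  then have rng: "0 \<le> a" "a < int p" "0 \<le> b" "b < int p" "0 \<le> c" "c < int p" "a \<noteq> 0"
    by (auto simp: R_def residue_ring_def)
  have pa: "\<not> int p dvd a" using rng by (auto dest: zdvd_imp_le)
  have disc: "\<not> int p dvd b\<^sup>2 - 4 * a * c" if p2: "p > 2"
  proof
    assume d: "int p dvd b\<^sup>2 - 4 * a * c"
    have pi: "Factorial_Ring.prime (int p)" using p by simp
    have n2: "\<not> int p dvd 2" using p2 by (auto dest: zdvd_imp_le)
    have "coprime (2 * a) (int p)"
      using pi pa n2 by (metis coprime_commute prime_imp_coprime prime_dvd_mult_iff)
    then obtain i where i: "[(2 * a) * i = 1] (mod int p)" using cong_solve_coprime_int by blast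
    define s where "s = (i * b) mod int p"
    have sc: "s \<in> carrier R" using p1 by (auto simp: s_def R_def residue_ring_def)
    have "[s = i * b] (mod int p)" by (simp add: s_def cong_def)
    then have "[(2 * a) * s = (2 * a) * (i * b)] (mod int p)" by (rule cong_scalar_left)
    also have "(2 * a) * (i * b) = ((2 * a) * i) * b" by simp
    also have "[((2 * a) * i) * b = 1 * b] (mod int p)" using i by (rule cong_scalar_right)
    finally have sb: "[(2 * a) * s = b] (mod int p)" by simp
    have "[((2 * a) * s)\<^sup>2 = b\<^sup>2] (mod int p)" using sb by (rule cong_pow)
    moreover have "[b\<^sup>2 = 4 * a * c] (mod int p)" using d by (simp add: cong_iff_dvd_diff)
    ultimately have "[((2 * a) * s)\<^sup>2 = 4 * a * c] (mod int p)" by (rule cong_trans)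
    then have "int p dvd ((2 * a) * s)\<^sup>2 - 4 * a * c" by (simp add: cong_iff_dvd_diff)
    also have "((2 * a) * s)\<^sup>2 - 4 * a * c = 2 * (2 * (a * (s * s * a - c)))"
      by (simp add: power2_eq_square algebra_simps)
    finally have "int p dvd s * s * a - c" using pi pa n2 by (simp only: prime_dvd_mult_iff) simp
    then have sc2: "(s * s * a) mod int p = c" using rng by (metis cong_def cong_iff_dvd_diff mod_pos_pos_trivial)
    have sb2: "((s + s) * a) mod int p = b"
      using sb rng by (simp add: cong_def algebra_simps)
    have "(s \<oplus>\<^bsub>R\<^esub> s) \<otimes>\<^bsub>R\<^esub> a = b" "(s \<otimes>\<^bsub>R\<^esub> s) \<otimes>\<^bsub>R\<^esub> a = c"
      using sb2 sc2 by (simp_all add: R_def residue_ring_def mod_mult_left_eq)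
    then show False
      using squarefree_quadratic_not_square[OF carr(1,4) sc] sf unfolding f_eq R_def[symmetric] by simp
  qed
  have eval: "ring.eval R f (x mod int p) = (a * x\<^sup>2 + b * x + c) mod int p" for x
  proof -
    have xc: "x mod int p \<in> carrier R" using p1 by (auto simp: R_def residue_ring_def)
    have "eval f (x mod int p) = a \<otimes>\<^bsub>R\<^esub> ((x mod int p) \<otimes>\<^bsub>R\<^esub> (x mod int p)) \<oplus>\<^bsub>R\<^esub>
        (b \<otimes>\<^bsub>R\<^esub> (x mod int p) \<oplus>\<^bsub>R\<^esub> c)"
      using carr xc by (simp add: f_eq numeral_2_eq_2)
    also have "\<dots> = (a * x\<^sup>2 + b * x + c) mod int p"
      by (simp add: R_def residue_ring_def power2_eq_square mod_simps add.assoc)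
    finally show ?thesis .
  qed
  show ?thesis using that[OF pa disc] eval unfolding R_def by blast
qed

lemma subgroup_units_residue_ring:
  fixes p :: nat and G :: "int set"
  assumes p: "Factorial_Ring.prime p" and G: "subgroup G (units_of (residue_ring (int p)))"
  shows "G \<subseteq> {1..<int p}"
    and "v \<in> G \<Longrightarrow> w \<in> G \<Longrightarrow> \<exists>g\<in>G. [v = g * w] (mod int p)"
proof -
  define R where "R = residue_ring (int p)"
  interpret residues_prime p R by unfold_locales (use p in \<open>auto simp: R_def\<close>)
  interpret U: group "units_of R" by (rule units_group)
  have G': "subgroup G (units_of R)" using G by (simp add: R_def)
  have sub: "G \<subseteq> Units R" using subgroup.subset[OF G'] by (simp add: units_of_carrier)
  moreover have "Units R \<subseteq> {1..<int p}"
    unfolding res_prime_units_eq using prime_gt_1_nat[OF p] by auto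
  ultimately show "G \<subseteq> {1..<int p}" by blast
  assume vw: "v \<in> G" "w \<in> G"
  define g where "g = v \<otimes>\<^bsub>units_of R\<^esub> inv\<^bsub>units_of R\<^esub> w"
  have "g \<in> G" using vw G' by (simp add: g_def subgroup.m_closed subgroup.m_inv_closed)
  moreover have "g \<otimes>\<^bsub>units_of R\<^esub> w = v"
  proof -
    have "v \<in> carrier (units_of R)" "w \<in> carrier (units_of R)"
      using vw subgroup.subset[OF G'] by auto
    then show ?thesis unfolding g_def by (simp add: U.m_assoc)
  qed
  then have "(g * w) mod int p = v" by (simp add: units_of_mult R_def residue_ring_def)
  then have "[v = g * w] (mod int p)" by (metis cong_def mod_mod_trivial)
  ultimately show "\<exists>g\<in>G. [v = g * w] (mod int p)" by blast
qed

section \<open>A uniform error function\<close>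

text \<open>
  The exponents that are admissible for all p, f, u and G at a given H. The error function is obtained
  as an infimum over this set.
\<close>

definition value_bound_exponents :: "nat \<Rightarrow> real set" where
  "value_bound_exponents H = {\<eta>. 0 \<le> \<eta> \<and>
    (\<forall>(p :: nat) (f :: int list) (u :: int) (G :: int set).
       Factorial_Ring.prime p \<longrightarrow>
       f \<in> carrier (univ_poly (residue_ring (int p)) (carrier (residue_ring (int p)))) \<longrightarrow>
       Polynomials.degree f = 2 \<longrightarrow>
       squarefree_in (univ_poly (residue_ring (int p)) (carrier (residue_ring (int p)))) f \<longrightarrow>
       subgroup G (units_of (residue_ring (int p))) \<longrightarrow>
       real (value_count (residue_ring (int p)) f (interval_mod p u H) G)
         \<le> (1 + real H powr (3/4) * real p powr (- 1/8)) * real (card G) powr (1/2) * real p powr \<eta>)}"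

lemma value_bound_exponents_mono:
  assumes "\<eta> \<in> value_bound_exponents H" "\<eta> \<le> \<theta>"
  shows "\<theta> \<in> value_bound_exponents H"
proof -
  have weaker: "(1 + real H powr (3/4) * real p powr (- 1/8)) * real T powr (1/2) * real p powr \<eta>
      \<le> (1 + real H powr (3/4) * real p powr (- 1/8)) * real T powr (1/2) * real p powr \<theta>"
    if "Factorial_Ring.prime p" for p T :: nat
    using assms(2) prime_ge_1_nat[OF that] by (intro mult_left_mono powr_mono) auto
  show ?thesis unfolding value_bound_exponents_def
  proof (intro CollectI conjI allI impI)
    show "0 \<le> \<theta>" using assms by (simp add: value_bound_exponents_def)
  next
    fix p :: nat and f :: "int list" and u :: int and G :: "int set"
    assume p: "Factorial_Ring.prime p"
      and "f \<in> carrier (univ_poly (residue_ring (int p)) (carrier (residue_ring (int p))))"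
        "Polynomials.degree f = 2"
        "squarefree_in (univ_poly (residue_ring (int p)) (carrier (residue_ring (int p)))) f"
        "subgroup G (units_of (residue_ring (int p)))"
    then have "real (value_count (residue_ring (int p)) f (interval_mod p u H) G)
         \<le> (1 + real H powr (3/4) * real p powr (- 1/8)) * real (card G) powr (1/2) * real p powr \<eta>"
      using assms(1) unfolding value_bound_exponents_def by blast
    then show "real (value_count (residue_ring (int p)) f (interval_mod p u H) G)
         \<le> (1 + real H powr (3/4) * real p powr (- 1/8)) * real (card G) powr (1/2) * real p powr \<theta>"
      using weaker[OF p] by (rule order_trans)
  qed
qed

text \<open>
  An exponent available for every H, so that the error function is defined also before the asymptotic
  range: N \<le> T \<le> T^(1/2) p^(1/2).
\<close>

lemma half_in_value_bound_exponents: "1/2 \<in> value_bound_exponents H"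
  unfolding value_bound_exponents_def
proof (intro CollectI conjI allI impI)
  fix p :: nat and f :: "int list" and u :: int and G :: "int set"
  assume p: "Factorial_Ring.prime p" and G: "subgroup G (units_of (residue_ring (int p)))"
  note Gp = subgroup_units_residue_ring(1)[OF p G]
  have fin: "finite G" using Gp finite_subset by blast
  define T where "T = real (card G)"
  have "real (value_count (residue_ring (int p)) f (interval_mod p u H) G) \<le> T"
    unfolding value_count_def T_def using fin by (simp add: card_mono)
  also have "T = T powr (1/2) * T powr (1/2)" by (simp add: T_def powr_half_sqrt)
  also have "\<dots> \<le> T powr (1/2) * real p powr (1/2)"
  proof (intro mult_left_mono powr_mono2)
    have "card G \<le> card {1..<int p}" using Gp by (intro card_mono) auto
    then show "T \<le> real p" by (simp add: T_def)
  qed (auto simp: T_def)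
  also have "\<dots> = 1 * T powr (1/2) * real p powr (1/2)" by simp
  also have "\<dots> \<le> (1 + real H powr (3/4) * real p powr (- 1/8)) * T powr (1/2) * real p powr (1/2)"
    by (intro mult_right_mono) auto
  finally show "real (value_count (residue_ring (int p)) f (interval_mod p u H) G)
      \<le> (1 + real H powr (3/4) * real p powr (- 1/8)) * real (card G) powr (1/2) * real p powr (1/2)"
    unfolding T_def .
qed simp

lemma eventually_in_value_bound_exponents:
  assumes "\<eta> > 0"
  shows "eventually (\<lambda>H. \<eta> \<in> value_bound_exponents H) sequentially"
proof -
  obtain H0 :: nat where H0:
    "\<And>(p :: nat) (H :: nat) (a :: int) b c u G.
       H \<ge> H0 \<Longrightarrow> Factorial_Ring.prime p \<Longrightarrow> \<not> int p dvd a \<Longrightarrow> (p > 2 \<Longrightarrow> \<not> int p dvd b\<^sup>2 - 4 * a * c) \<Longrightarrow>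
       G \<subseteq> {1..<int p} \<Longrightarrow>
       (\<And>v w. v \<in> G \<Longrightarrow> w \<in> G \<Longrightarrow> \<exists>g\<in>G. [v = g * w] (mod int p)) \<Longrightarrow>
       real (card ((\<lambda>x. (a * x\<^sup>2 + b * x + c) mod int p) ` {u + 1..u + int H} \<inter> G))
         \<le> (1 + real H powr (3/4) * real p powr (-1/8)) * real (card G) powr (1/2) * real p powr \<eta>"
    using quadratic_values_in_group_bound[OF assms] by blast
  have "\<eta> \<in> value_bound_exponents H" if H: "H \<ge> H0" for H
    unfolding value_bound_exponents_def
  proof (intro CollectI conjI allI impI)
    fix p :: nat and f :: "int list" and u :: int and G :: "int set"
    assume p: "Factorial_Ring.prime p"
      and f: "f \<in> carrier (univ_poly (residue_ring (int p)) (carrier (residue_ring (int p))))"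
        "Polynomials.degree f = 2"
        "squarefree_in (univ_poly (residue_ring (int p)) (carrier (residue_ring (int p)))) f"
      and G: "subgroup G (units_of (residue_ring (int p)))"
    obtain a b c :: int where abc: "\<not> int p dvd a" "p > 2 \<Longrightarrow> \<not> int p dvd b\<^sup>2 - 4 * a * c"
      "\<And>x. ring.eval (residue_ring (int p)) f (x mod int p) = (a * x\<^sup>2 + b * x + c) mod int p"
      using quadratic_over_residue_ring[OF p f] by blast
    have "ring.eval (residue_ring (int p)) f ` interval_mod p u H
        = (\<lambda>x. (a * x\<^sup>2 + b * x + c) mod int p) ` {u + 1..u + int H}"
      unfolding interval_mod_def image_image abc(3) ..
    then show "real (value_count (residue_ring (int p)) f (interval_mod p u H) G)
      \<le> (1 + real H powr (3/4) * real p powr (- 1/8)) * real (card G) powr (1/2) * real p powr \<eta>"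
      unfolding value_count_def
      using H0[OF H p abc(1,2) subgroup_units_residue_ring[OF p G]] by simp
  qed (use assms in simp)
  then show ?thesis unfolding eventually_sequentially by blast
qed

theorem theorem7:
  shows "\<exists>\<epsilon> :: nat \<Rightarrow> real. \<epsilon> \<longlonglongrightarrow> 0 \<and>
    (\<forall>(p :: nat) (f :: int list) (u :: int) (H :: nat) (G :: int set) (T :: nat).
       Factorial_Ring.prime p \<longrightarrow>
       f \<in> carrier (univ_poly (residue_ring (int p)) (carrier (residue_ring (int p)))) \<longrightarrow>
       Polynomials.degree f = 2 \<longrightarrow>
       squarefree_in (univ_poly (residue_ring (int p)) (carrier (residue_ring (int p)))) f \<longrightarrow>
       subgroup G (units_of (residue_ring (int p))) \<longrightarrow>
       card G = T \<longrightarrow>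
       (\<exists>\<delta> :: real. \<bar>\<delta>\<bar> \<le> \<epsilon> H \<and>
          real (value_count (residue_ring (int p)) f (interval_mod p u H) G)
            \<le> (1 + real H powr (3/4) * real p powr (- 1/8)) * real T powr (1/2) * real p powr \<delta>))"
proof -
  \<comment> \<open>The infimum need not be attained; adding a null sequence makes the value admissible.\<close>
  define \<epsilon> where "\<epsilon> H = Inf (value_bound_exponents H) + 1 / (real H + 1)" for H
  have ne: "value_bound_exponents H \<noteq> {}" for H using half_in_value_bound_exponents by blast
  have bdd: "bdd_below (value_bound_exponents H)" for H
    by (rule bdd_belowI[of _ 0]) (simp add: value_bound_exponents_def)
  have Inf0: "0 \<le> Inf (value_bound_exponents H)" for H
    using ne by (rule cInf_greatest) (simp add: value_bound_exponents_def)
  have mem: "\<epsilon> H \<in> value_bound_exponents H" for H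
  proof -
    have "Inf (value_bound_exponents H) < \<epsilon> H" by (simp add: \<epsilon>_def)
    then obtain \<eta> where "\<eta> \<in> value_bound_exponents H" "\<eta> < \<epsilon> H"
      using cInf_less_iff[OF ne bdd] by blast
    then show ?thesis using value_bound_exponents_mono by (meson less_imp_le)
  qed
  have "(\<lambda>H. Inf (value_bound_exponents H)) \<longlonglongrightarrow> 0"
  proof (rule order_tendstoI)
    fix a :: real assume "a < 0"
    then show "eventually (\<lambda>H. a < Inf (value_bound_exponents H)) sequentially"
      using Inf0 by (intro always_eventually allI) (rule less_le_trans)
  next
    fix a :: real assume "0 < a"
    then have "eventually (\<lambda>H. a / 2 \<in> value_bound_exponents H) sequentially"
      by (intro eventually_in_value_bound_exponents) simp
    then show "eventually (\<lambda>H. Inf (value_bound_exponents H) < a) sequentially"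
    proof (rule eventually_mono)
      fix H assume "a / 2 \<in> value_bound_exponents H"
      then have "Inf (value_bound_exponents H) \<le> a / 2" using bdd by (rule cInf_lower)
      then show "Inf (value_bound_exponents H) < a" using \<open>0 < a\<close> by simp
    qed
  qed
  moreover have "(\<lambda>H. 1 / (real H + 1)) \<longlonglongrightarrow> 0"
    using LIMSEQ_inverse_real_of_nat by (simp add: inverse_eq_divide add.commute)
  ultimately have "\<epsilon> \<longlonglongrightarrow> 0"
    unfolding \<epsilon>_def using tendsto_add[of _ 0 _ _ 0] by fastforce
  moreover have "\<bar>\<epsilon> H\<bar> \<le> \<epsilon> H" for H using Inf0[of H] by (simp add: \<epsilon>_def)
  ultimately show ?thesis
    using mem unfolding value_bound_exponents_def by (intro exI[of _ \<epsilon>]) blast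
qed

end
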